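(* Let $\mathcal{K}$ be an essentially small tensor triangulated category. Then the following are equivalent: (a) every radical ideal in $\mathcal{K}$ is finitely generated; (b) every prime ideal in $\mathcal{K}$ is finitely generated; (c) $\operatorname{Spc}(\mathcal{K})$ is inverse-Noetherian.
   Context: A tensor triangulated category (tt-category) is a triangulated category $\mathcal{K}$ with a symmetric monoidal structure $(\otimes,\mathbb{1})$ whose tensor product is exact in each variable. An ideal in $\mathcal{K}$ means a thick tensor ideal: a full triangulated subcategory closed under direct summands and under tensoring with arbitrary objects of $\mathcal{K}$. For a collection of objects $X_1,\dots,X_n$, $\langle X_1,\dots,X_n\rangle_\otimes$ denotes the smallest ideal containing them. The radical of an ideal $\mathcal{I}$ is $\sqrt{\mathcal{I}}=\{x\in\mathcal{K} : x^{\otimes n}\in\mathcal{I}\text{ for some } n\geq 1\}$, and $\mathcal{I}$ is radical if $\sqrt{\mathcal{I}}=\mathcal{I}$. A radical ideal $\mathcal{I}$ is finitely generated if there are finitely many objects $X_1,\dots,X_n\in\mathcal{K}$ with $\mathcal{I}=\sqrt{\langle X_1,\dots,X_n\rangle_\otimes}$. A prime ideal is a proper ideal $\mathcal{P}$ such that $x\otimes y\in\mathcal{P}$ implies $x\in\mathcal{P}$ or $y\in\mathcal{P}$; prime ideals are radical. The (Balmer) spectrum $\operatorname{Spc}(\mathcal{K})$ is the set of prime ideals of $\mathcal{K}$ with the topology having the sets $\operatorname{supp}(x)=\{\mathcal{P} : x\notin\mathcal{P}\}$, $x\in\mathcal{K}$, as a basis of closed subsets; it is a spectral space. For a spectral space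 $X$, the inverse (Hochster dual) space $X_{\mathrm{inv}}$ is the same set with the topology having the quasi-compact open subsets of $X$ as a basis of closed subsets. $X$ is inverse-Noetherian if $X_{\mathrm{inv}}$ is a Noetherian topological space. *)

theory Defs
  imports "HOL-Analysis.Analysis" "HOL-Algebra.Group"
begin

section \<open>Categories\<close>

text \<open>
  A category is given by carrier sets of objects and of morphisms inside two types;
  \<open>Comp K g f\<close>, written \<open>g \<cdot> f\<close>, is "first \<open>f\<close>, then \<open>g\<close>", and only its values on
  composable morphisms matter. As the objects form a set, essential smallness is built in.
\<close>

record ('o, 'm) cat =
  Ob :: "'o set"
  Arr :: "'m set"
  Dom :: "'m \<Rightarrow> 'o"
  Cod :: "'m \<Rightarrow> 'o"
  Id :: "'o \<Rightarrow> 'm"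
  Comp :: "'m \<Rightarrow> 'm \<Rightarrow> 'm" (infixl "\<cdot>\<index>" 70)

definition Hom :: "('o, 'm, 'z) cat_scheme \<Rightarrow> 'o \<Rightarrow> 'o \<Rightarrow> 'm set" where
  "Hom K X Y = {f \<in> Arr K. Dom K f = X \<and> Cod K f = Y}"

locale category =
  fixes K :: "('o, 'm, 'z) cat_scheme" (structure)
  assumes Dom_Ob: "f \<in> Arr K \<Longrightarrow> Dom K f \<in> Ob K"
    and Cod_Ob: "f \<in> Arr K \<Longrightarrow> Cod K f \<in> Ob K"
    and Id_Hom: "X \<in> Ob K \<Longrightarrow> Id K X \<in> Hom K X X"
    and Comp_Hom: "\<lbrakk>f \<in> Hom K X Y; g \<in> Hom K Y Z\<rbrakk> \<Longrightarrow> g \<cdot> f \<in> Hom K X Z"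
    and Comp_Id: "f \<in> Hom K X Y \<Longrightarrow> f \<cdot> Id K X = f"
    and Id_Comp: "f \<in> Hom K X Y \<Longrightarrow> Id K Y \<cdot> f = f"
    and Comp_assoc: "\<lbrakk>f \<in> Hom K W X; g \<in> Hom K X Y; h \<in> Hom K Y Z\<rbrakk>
      \<Longrightarrow> (h \<cdot> g) \<cdot> f = h \<cdot> (g \<cdot> f)"

definition is_iso :: "('o, 'm, 'z) cat_scheme \<Rightarrow> 'm \<Rightarrow> bool" where
  "is_iso K f \<longleftrightarrow> f \<in> Arr K \<and>
     (\<exists>g \<in> Hom K (Cod K f) (Dom K f).
        g \<cdot>\<^bsub>K\<^esub> f = Id K (Dom K f) \<and> f \<cdot>\<^bsub>K\<^esub> g = Id K (Cod K f))"

definition isomorphic :: "('o, 'm, 'z) cat_scheme \<Rightarrow> 'o \<Rightarrow> 'o \<Rightarrow> bool" where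
  "isomorphic K X Y \<longleftrightarrow> (\<exists>f \<in> Hom K X Y. is_iso K f)"

definition zero_object :: "('o, 'm, 'z) cat_scheme \<Rightarrow> 'o \<Rightarrow> bool" where
  "zero_object K Z \<longleftrightarrow> Z \<in> Ob K \<and>
     (\<forall>X \<in> Ob K. (\<exists>!f. f \<in> Hom K X Z) \<and> (\<exists>!f. f \<in> Hom K Z X))"

text \<open>An endofunctor is a pair consisting of its object map and its morphism map.\<close>

definition endofunctor :: "('o, 'm, 'z) cat_scheme \<Rightarrow> ('o \<Rightarrow> 'o) \<Rightarrow> ('m \<Rightarrow> 'm) \<Rightarrow> bool" where
  "endofunctor K Fo Fa \<longleftrightarrow>
     (\<forall>X \<in> Ob K. Fo X \<in> Ob K) \<and>
     (\<forall>X \<in> Ob K. \<forall>Y \<in> Ob K. \<forall>f \<in> Hom K X Y. Fa f \<in> Hom K (Fo X) (Fo Y)) \<and>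
     (\<forall>X \<in> Ob K. Fa (Id K X) = Id K (Fo X)) \<and>
     (\<forall>X \<in> Ob K. \<forall>Y \<in> Ob K. \<forall>Z \<in> Ob K. \<forall>f \<in> Hom K X Y. \<forall>g \<in> Hom K Y Z.
        Fa (g \<cdot>\<^bsub>K\<^esub> f) = Fa g \<cdot>\<^bsub>K\<^esub> Fa f)"

text \<open>\<open>Fo\<close>/\<open>Fa\<close> is an equivalence: fully faithful and essentially surjective.\<close>

definition autoequivalence :: "('o, 'm, 'z) cat_scheme \<Rightarrow> ('o \<Rightarrow> 'o) \<Rightarrow> ('m \<Rightarrow> 'm) \<Rightarrow> bool" where
  "autoequivalence K Fo Fa \<longleftrightarrow> endofunctor K Fo Fa \<and>
     (\<forall>X \<in> Ob K. \<forall>Y \<in> Ob K. bij_betw Fa (Hom K X Y) (Hom K (Fo X) (Fo Y))) \<and>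
     (\<forall>Y \<in> Ob K. \<exists>X \<in> Ob K. isomorphic K (Fo X) Y)"


section \<open>Additive categories\<close>

record ('o, 'm) additive_cat = "('o, 'm) cat" +
  Add :: "'m \<Rightarrow> 'm \<Rightarrow> 'm" (infixl "\<uplus>\<index>" 65)
  Zero :: "'o \<Rightarrow> 'o \<Rightarrow> 'm"

definition Hom_group :: "('o, 'm, 'z) additive_cat_scheme \<Rightarrow> 'o \<Rightarrow> 'o \<Rightarrow> 'm monoid" where
  "Hom_group K X Y = \<lparr>carrier = Hom K X Y, mult = Add K, one = Zero K X Y\<rparr>"

definition Neg :: "('o, 'm, 'z) additive_cat_scheme \<Rightarrow> 'm \<Rightarrow> 'm" where
  "Neg K f = inv\<^bsub>Hom_group K (Dom K f) (Cod K f)\<^esub> f"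

text \<open>\<open>W\<close> is a direct sum of \<open>X\<close> and \<open>Y\<close>.\<close>

definition direct_sum :: "('o, 'm, 'z) additive_cat_scheme \<Rightarrow> 'o \<Rightarrow> 'o \<Rightarrow> 'o \<Rightarrow> bool" where
  "direct_sum K X Y W \<longleftrightarrow> X \<in> Ob K \<and> Y \<in> Ob K \<and> W \<in> Ob K \<and>
     (\<exists>i \<in> Hom K X W. \<exists>j \<in> Hom K Y W. \<exists>p \<in> Hom K W X. \<exists>q \<in> Hom K W Y.
        p \<cdot>\<^bsub>K\<^esub> i = Id K X \<and> q \<cdot>\<^bsub>K\<^esub> j = Id K Y \<and>
        p \<cdot>\<^bsub>K\<^esub> j = Zero K Y X \<and> q \<cdot>\<^bsub>K\<^esub> i = Zero K X Y \<and>
        (i \<cdot>\<^bsub>K\<^esub> p) \<uplus>\<^bsub>K\<^esub> (j \<cdot>\<^bsub>K\<^esub> q) = Id K W)"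

locale additive_category = category K
  for K :: "('o, 'm, 'z) additive_cat_scheme" (structure) +
  assumes Hom_comm_group: "\<lbrakk>X \<in> Ob K; Y \<in> Ob K\<rbrakk> \<Longrightarrow> comm_group (Hom_group K X Y)"
    and Comp_Add: "\<lbrakk>f \<in> Hom K X Y; f' \<in> Hom K X Y; g \<in> Hom K Y Z\<rbrakk>
      \<Longrightarrow> g \<cdot> (f \<uplus> f') = (g \<cdot> f) \<uplus> (g \<cdot> f')"
    and Add_Comp: "\<lbrakk>f \<in> Hom K X Y; g \<in> Hom K Y Z; g' \<in> Hom K Y Z\<rbrakk>
      \<Longrightarrow> (g \<uplus> g') \<cdot> f = (g \<cdot> f) \<uplus> (g' \<cdot> f)"
    and zero_object_exists: "\<exists>Z. zero_object K Z"
    and direct_sum_exists: "\<lbrakk>X \<in> Ob K; Y \<in> Ob K\<rbrakk> \<Longrightarrow> \<exists>W. direct_sum K X Y W"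

definition additive_endofunctor ::
    "('o, 'm, 'z) additive_cat_scheme \<Rightarrow> ('o \<Rightarrow> 'o) \<Rightarrow> ('m \<Rightarrow> 'm) \<Rightarrow> bool" where
  "additive_endofunctor K Fo Fa \<longleftrightarrow> endofunctor K Fo Fa \<and>
     (\<forall>X \<in> Ob K. \<forall>Y \<in> Ob K. \<forall>f \<in> Hom K X Y. \<forall>g \<in> Hom K X Y.
        Fa (f \<uplus>\<^bsub>K\<^esub> g) = Fa f \<uplus>\<^bsub>K\<^esub> Fa g)"


section \<open>Triangulated categories\<close>

text \<open>
  \<open>ShO\<close>/\<open>ShA\<close> is the suspension functor \<open>\<Sigma>\<close>; a triple \<open>(f, g, h)\<close> stands for the
  diagram \<open>X \<longrightarrow> Y \<longrightarrow> Z \<longrightarrow> \<Sigma>X\<close>, and \<open>Tri\<close> is the set of distinguished triangles.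
\<close>

record ('o, 'm) triangulated_cat = "('o, 'm) additive_cat" +
  ShO :: "'o \<Rightarrow> 'o"
  ShA :: "'m \<Rightarrow> 'm"
  Tri :: "('m \<times> 'm \<times> 'm) set"

definition is_triangle :: "('o, 'm, 'z) triangulated_cat_scheme \<Rightarrow> 'm \<times> 'm \<times> 'm \<Rightarrow> bool" where
  "is_triangle K = (\<lambda>(f, g, h). f \<in> Arr K \<and> g \<in> Arr K \<and> h \<in> Arr K \<and>
     Cod K f = Dom K g \<and> Cod K g = Dom K h \<and> Cod K h = ShO K (Dom K f))"

definition triangle_map :: "('o, 'm, 'z) triangulated_cat_scheme
    \<Rightarrow> 'm \<times> 'm \<times> 'm \<Rightarrow> 'm \<times> 'm \<times> 'm \<Rightarrow> 'm \<times> 'm \<times> 'm \<Rightarrow> bool" where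
  "triangle_map K = (\<lambda>(f, g, h) (f', g', h') (a, b, c).
     a \<in> Hom K (Dom K f) (Dom K f') \<and>
     b \<in> Hom K (Dom K g) (Dom K g') \<and>
     c \<in> Hom K (Dom K h) (Dom K h') \<and>
     b \<cdot>\<^bsub>K\<^esub> f = f' \<cdot>\<^bsub>K\<^esub> a \<and>
     c \<cdot>\<^bsub>K\<^esub> g = g' \<cdot>\<^bsub>K\<^esub> b \<and>
     ShA K a \<cdot>\<^bsub>K\<^esub> h = h' \<cdot>\<^bsub>K\<^esub> c)"

locale triangulated_category = additive_category K
  for K :: "('o, 'm, 'z) triangulated_cat_scheme" (structure) +
  assumes shift_autoequivalence: "autoequivalence K (ShO K) (ShA K)"
    and shift_additive: "additive_endofunctor K (ShO K) (ShA K)"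
    and Tri_is_triangle: "T \<in> Tri K \<Longrightarrow> is_triangle K T"
    and TR1_id: "\<lbrakk>X \<in> Ob K; zero_object K Z\<rbrakk>
      \<Longrightarrow> (Id K X, Zero K X Z, Zero K Z (ShO K X)) \<in> Tri K"
    and TR1_cone: "f \<in> Arr K \<Longrightarrow> \<exists>g h. (f, g, h) \<in> Tri K"
    and TR1_iso: "\<lbrakk>T \<in> Tri K; is_triangle K T'; triangle_map K T T' (a, b, c);
        is_iso K a; is_iso K b; is_iso K c\<rbrakk> \<Longrightarrow> T' \<in> Tri K"
    and TR2: "is_triangle K (f, g, h)
      \<Longrightarrow> (f, g, h) \<in> Tri K \<longleftrightarrow> (g, h, Neg K (ShA K f)) \<in> Tri K"
    and TR3: "\<lbrakk>(f, g, h) \<in> Tri K; (f', g', h') \<in> Tri K;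
        a \<in> Hom K (Dom K f) (Dom K f'); b \<in> Hom K (Cod K f) (Cod K f'); b \<cdot> f = f' \<cdot> a\<rbrakk>
      \<Longrightarrow> \<exists>c. triangle_map K (f, g, h) (f', g', h') (a, b, c)"
    \<comment> \<open>octahedral axiom, for \<open>f : X \<longrightarrow> Y\<close>, \<open>g : Y \<longrightarrow> Z\<close> and chosen cones
       \<open>A\<close>, \<open>B\<close>, \<open>C\<close> of \<open>f\<close>, \<open>g \<cdot> f\<close>, \<open>g\<close>\<close>
    and TR4: "\<lbrakk>(f, u, v) \<in> Tri K; (g \<cdot> f, r, s) \<in> Tri K; (g, k, l) \<in> Tri K;
        f \<in> Hom K X Y; g \<in> Hom K Y Z; u \<in> Hom K Y A; r \<in> Hom K Z B; k \<in> Hom K Z C\<rbrakk>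
      \<Longrightarrow> \<exists>a \<in> Hom K A B. \<exists>b \<in> Hom K B C.
            (a, b, ShA K u \<cdot> l) \<in> Tri K \<and>
            a \<cdot> u = r \<cdot> g \<and> s \<cdot> a = v \<and> b \<cdot> r = k \<and> l \<cdot> b = ShA K f \<cdot> s"

text \<open>
  Exact endofunctors: additive, commuting with the suspension up to a natural isomorphism
  \<open>\<phi>\<^sub>X : F\<Sigma>X \<longrightarrow> \<Sigma>FX\<close>, and sending distinguished triangles to distinguished triangles
  by means of \<open>\<phi>\<close>.
\<close>

definition exact_endofunctor ::
    "('o, 'm, 'z) triangulated_cat_scheme \<Rightarrow> ('o \<Rightarrow> 'o) \<Rightarrow> ('m \<Rightarrow> 'm) \<Rightarrow> bool" where
  "exact_endofunctor K Fo Fa \<longleftrightarrow> additive_endofunctor K Fo Fa \<and>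
     (\<exists>\<phi>.
        (\<forall>X \<in> Ob K. \<phi> X \<in> Hom K (Fo (ShO K X)) (ShO K (Fo X)) \<and> is_iso K (\<phi> X)) \<and>
        (\<forall>X \<in> Ob K. \<forall>Y \<in> Ob K. \<forall>f \<in> Hom K X Y.
           \<phi> Y \<cdot>\<^bsub>K\<^esub> Fa (ShA K f) = ShA K (Fa f) \<cdot>\<^bsub>K\<^esub> \<phi> X) \<and>
        (\<forall>f g h. (f, g, h) \<in> Tri K \<longrightarrow> (Fa f, Fa g, \<phi> (Dom K f) \<cdot>\<^bsub>K\<^esub> Fa h) \<in> Tri K))"


section \<open>Tensor triangulated categories\<close>

record ('o, 'm) tt_cat = "('o, 'm) triangulated_cat" +
  TenO :: "'o \<Rightarrow> 'o \<Rightarrow> 'o" (infixl "\<odot>\<index>" 75)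
  TenA :: "'m \<Rightarrow> 'm \<Rightarrow> 'm" (infixl "\<oslash>\<index>" 75)
  Unit :: "'o"
  Assoc :: "'o \<Rightarrow> 'o \<Rightarrow> 'o \<Rightarrow> 'm"
  LUnit :: "'o \<Rightarrow> 'm"
  RUnit :: "'o \<Rightarrow> 'm"
  Braid :: "'o \<Rightarrow> 'o \<Rightarrow> 'm"

text \<open>
  \<open>\<odot>\<close> and \<open>\<oslash>\<close> are the tensor product on objects and on morphisms. The structure
  isomorphisms are \<open>Assoc : (X \<odot> Y) \<odot> Z \<longrightarrow> X \<odot> (Y \<odot> Z)\<close>,
  \<open>LUnit : Unit \<odot> X \<longrightarrow> X\<close>, \<open>RUnit : X \<odot> Unit \<longrightarrow> X\<close>, \<open>Braid : X \<odot> Y \<longrightarrow> Y \<odot> X\<close>.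
\<close>

locale symmetric_monoidal_category = category K
  for K :: "('o, 'm, 'z) tt_cat_scheme" (structure) +
  assumes TenO_Ob: "\<lbrakk>X \<in> Ob K; Y \<in> Ob K\<rbrakk> \<Longrightarrow> X \<odot> Y \<in> Ob K"
    and TenA_Hom: "\<lbrakk>f \<in> Hom K X X'; g \<in> Hom K Y Y'\<rbrakk>
      \<Longrightarrow> f \<oslash> g \<in> Hom K (X \<odot> Y) (X' \<odot> Y')"
    and TenA_Id: "\<lbrakk>X \<in> Ob K; Y \<in> Ob K\<rbrakk> \<Longrightarrow> Id K X \<oslash> Id K Y = Id K (X \<odot> Y)"
    and TenA_Comp: "\<lbrakk>f \<in> Hom K X X'; f' \<in> Hom K X' X''; g \<in> Hom K Y Y'; g' \<in> Hom K Y' Y''\<rbrakk>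
      \<Longrightarrow> (f' \<cdot> f) \<oslash> (g' \<cdot> g) = (f' \<oslash> g') \<cdot> (f \<oslash> g)"
    and Unit_Ob: "Unit K \<in> Ob K"
    and Assoc_iso: "\<lbrakk>X \<in> Ob K; Y \<in> Ob K; Z \<in> Ob K\<rbrakk>
      \<Longrightarrow> Assoc K X Y Z \<in> Hom K ((X \<odot> Y) \<odot> Z) (X \<odot> (Y \<odot> Z)) \<and> is_iso K (Assoc K X Y Z)"
    and LUnit_iso: "X \<in> Ob K
      \<Longrightarrow> LUnit K X \<in> Hom K (Unit K \<odot> X) X \<and> is_iso K (LUnit K X)"
    and RUnit_iso: "X \<in> Ob K
      \<Longrightarrow> RUnit K X \<in> Hom K (X \<odot> Unit K) X \<and> is_iso K (RUnit K X)"
    and Braid_iso: "\<lbrakk>X \<in> Ob K; Y \<in> Ob K\<rbrakk>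
      \<Longrightarrow> Braid K X Y \<in> Hom K (X \<odot> Y) (Y \<odot> X) \<and> is_iso K (Braid K X Y)"
    and Assoc_natural: "\<lbrakk>f \<in> Hom K X X'; g \<in> Hom K Y Y'; h \<in> Hom K Z Z'\<rbrakk>
      \<Longrightarrow> Assoc K X' Y' Z' \<cdot> ((f \<oslash> g) \<oslash> h) = (f \<oslash> (g \<oslash> h)) \<cdot> Assoc K X Y Z"
    and LUnit_natural: "f \<in> Hom K X Y
      \<Longrightarrow> LUnit K Y \<cdot> (Id K (Unit K) \<oslash> f) = f \<cdot> LUnit K X"
    and RUnit_natural: "f \<in> Hom K X Y
      \<Longrightarrow> RUnit K Y \<cdot> (f \<oslash> Id K (Unit K)) = f \<cdot> RUnit K X"
    and Braid_natural: "\<lbrakk>f \<in> Hom K X X'; g \<in> Hom K Y Y'\<rbrakk>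
      \<Longrightarrow> Braid K X' Y' \<cdot> (f \<oslash> g) = (g \<oslash> f) \<cdot> Braid K X Y"
    and pentagon: "\<lbrakk>W \<in> Ob K; X \<in> Ob K; Y \<in> Ob K; Z \<in> Ob K\<rbrakk>
      \<Longrightarrow> Assoc K W X (Y \<odot> Z) \<cdot> Assoc K (W \<odot> X) Y Z
        = (Id K W \<oslash> Assoc K X Y Z) \<cdot> (Assoc K W (X \<odot> Y) Z \<cdot> (Assoc K W X Y \<oslash> Id K Z))"
    and unit_coherence: "\<lbrakk>X \<in> Ob K; Y \<in> Ob K\<rbrakk>
      \<Longrightarrow> (Id K X \<oslash> LUnit K Y) \<cdot> Assoc K X (Unit K) Y = RUnit K X \<oslash> Id K Y"
    and hexagon: "\<lbrakk>X \<in> Ob K; Y \<in> Ob K; Z \<in> Ob K\<rbrakk>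
      \<Longrightarrow> Assoc K Y Z X \<cdot> (Braid K X (Y \<odot> Z) \<cdot> Assoc K X Y Z)
        = (Id K Y \<oslash> Braid K X Z) \<cdot> (Assoc K Y X Z \<cdot> (Braid K X Y \<oslash> Id K Z))"
    and symmetry: "\<lbrakk>X \<in> Ob K; Y \<in> Ob K\<rbrakk>
      \<Longrightarrow> Braid K Y X \<cdot> Braid K X Y = Id K (X \<odot> Y)"

locale tt_category = triangulated_category K + symmetric_monoidal_category K
  for K :: "('o, 'm, 'z) tt_cat_scheme" (structure) +
  assumes tensor_exact_right: "X \<in> Ob K \<Longrightarrow> exact_endofunctor K (\<lambda>Y. X \<odot> Y) (\<lambda>f. Id K X \<oslash> f)"
    and tensor_exact_left: "X \<in> Ob K \<Longrightarrow> exact_endofunctor K (\<lambda>Y. Y \<odot> X) (\<lambda>f. f \<oslash> Id K X)"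


section \<open>Thick tensor ideals\<close>

text \<open>Full subcategories are represented by their sets of objects.\<close>

definition triangulated_subcategory ::
    "('o, 'm, 'z) triangulated_cat_scheme \<Rightarrow> 'o set \<Rightarrow> bool" where
  "triangulated_subcategory K S \<longleftrightarrow> S \<subseteq> Ob K \<and>
     (\<forall>Z. zero_object K Z \<longrightarrow> Z \<in> S) \<and>
     (\<forall>X Y W. X \<in> S \<and> Y \<in> S \<and> direct_sum K X Y W \<longrightarrow> W \<in> S) \<and>
     (\<forall>X \<in> S. \<forall>Y \<in> Ob K. isomorphic K X Y \<longrightarrow> Y \<in> S) \<and>
     (\<forall>X \<in> Ob K. ShO K X \<in> S \<longleftrightarrow> X \<in> S) \<and>
     (\<forall>f g h. (f, g, h) \<in> Tri K \<and> Dom K f \<in> S \<and> Cod K f \<in> S \<longrightarrow> Cod K g \<in> S)"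

definition tt_ideal :: "('o, 'm, 'z) tt_cat_scheme \<Rightarrow> 'o set \<Rightarrow> bool" where
  "tt_ideal K I \<longleftrightarrow> triangulated_subcategory K I \<and>
     (\<forall>X Y W. direct_sum K X Y W \<and> W \<in> I \<longrightarrow> X \<in> I \<and> Y \<in> I) \<and>
     (\<forall>X \<in> I. \<forall>Y \<in> Ob K. X \<odot>\<^bsub>K\<^esub> Y \<in> I \<and> Y \<odot>\<^bsub>K\<^esub> X \<in> I)"

definition ideal_generated :: "('o, 'm, 'z) tt_cat_scheme \<Rightarrow> 'o set \<Rightarrow> 'o set" where
  "ideal_generated K F = \<Inter>{I. tt_ideal K I \<and> F \<subseteq> I}"

text \<open>The value of \<open>tensor_power\<close> at exponent \<open>0\<close> plays no role below.\<close>

fun tensor_power :: "('o, 'm, 'z) tt_cat_scheme \<Rightarrow> 'o \<Rightarrow> nat \<Rightarrow> 'o" where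
  "tensor_power K X 0 = Unit K"
| "tensor_power K X (Suc 0) = X"
| "tensor_power K X (Suc (Suc n)) = tensor_power K X (Suc n) \<odot>\<^bsub>K\<^esub> X"

definition tt_radical :: "('o, 'm, 'z) tt_cat_scheme \<Rightarrow> 'o set \<Rightarrow> 'o set" where
  "tt_radical K I = {X \<in> Ob K. \<exists>n\<ge>1. tensor_power K X n \<in> I}"

definition radical_ideal :: "('o, 'm, 'z) tt_cat_scheme \<Rightarrow> 'o set \<Rightarrow> bool" where
  "radical_ideal K I \<longleftrightarrow> tt_ideal K I \<and> tt_radical K I = I"

text \<open>Finite generation is meant up to radicals.\<close>

definition fin_gen_radical :: "('o, 'm, 'z) tt_cat_scheme \<Rightarrow> 'o set \<Rightarrow> bool" where
  "fin_gen_radical K I \<longleftrightarrow>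
     (\<exists>F. finite F \<and> F \<subseteq> Ob K \<and> I = tt_radical K (ideal_generated K F))"

definition prime_ideal :: "('o, 'm, 'z) tt_cat_scheme \<Rightarrow> 'o set \<Rightarrow> bool" where
  "prime_ideal K P \<longleftrightarrow> tt_ideal K P \<and> P \<noteq> Ob K \<and>
     (\<forall>X \<in> Ob K. \<forall>Y \<in> Ob K. X \<odot>\<^bsub>K\<^esub> Y \<in> P \<longrightarrow> X \<in> P \<or> Y \<in> P)"


section \<open>The spectrum and the inverse topology\<close>

text \<open>
  The topology on \<open>S\<close> whose closed sets are the intersections of members of \<open>\<B>\<close>
  (all relative to \<open>S\<close>), i.e. whose open sets are the unions of complements of members.
\<close>

definition closed_base_topology :: "'a set \<Rightarrow> 'a set set \<Rightarrow> 'a topology" where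
  "closed_base_topology S \<B> = topology (arbitrary union_of (\<lambda>U. \<exists>C \<in> \<B>. U = S - C))"

definition Spc :: "('o, 'm, 'z) tt_cat_scheme \<Rightarrow> 'o set set" where
  "Spc K = {P. prime_ideal K P}"

definition supp :: "('o, 'm, 'z) tt_cat_scheme \<Rightarrow> 'o \<Rightarrow> 'o set set" where
  "supp K X = {P \<in> Spc K. X \<notin> P}"

definition Spc_topology :: "('o, 'm, 'z) tt_cat_scheme \<Rightarrow> 'o set topology" where
  "Spc_topology K = closed_base_topology (Spc K) (supp K ` Ob K)"

definition inverse_topology :: "'a topology \<Rightarrow> 'a topology" where
  "inverse_topology X = closed_base_topology (topspace X) {C. openin X C \<and> compactin X C}"

definition noetherian_space :: "'a topology \<Rightarrow> bool" where
  "noetherian_space X \<longleftrightarrow>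
     (\<forall>C :: nat \<Rightarrow> 'a set. (\<forall>n. closedin X (C n)) \<and> decseq C \<longrightarrow> (\<exists>N. \<forall>n\<ge>N. C n = C N))"

definition inverse_noetherian :: "'a topology \<Rightarrow> bool" where
  "inverse_noetherian X \<longleftrightarrow> noetherian_space (inverse_topology X)"

text \<open>
  The constant \<open>topology\<close> is only meaningful on families that are topologies. The following
  facts confirm this for the two uses above.
\<close>

lemma openin_closed_base_topology:
  assumes "\<And>C D. \<lbrakk>C \<in> \<B>; D \<in> \<B>\<rbrakk> \<Longrightarrow> C \<union> D \<in> \<B>"
  shows "openin (closed_base_topology S \<B>) = arbitrary union_of (\<lambda>U. \<exists>C \<in> \<B>. U = S - C)"
proof -
  have "istopology (arbitrary union_of (\<lambda>U. \<exists>C \<in> \<B>. U = S - C))"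
  proof (rule istopology_base)
    fix U V assume "\<exists>C \<in> \<B>. U = S - C" "\<exists>C \<in> \<B>. V = S - C"
    then obtain C D where "C \<in> \<B>" "D \<in> \<B>" "U \<inter> V = S - (C \<union> D)" by blast
    then show "\<exists>C \<in> \<B>. U \<inter> V = S - C" using assms by blast
  qed
  then show ?thesis
    unfolding closed_base_topology_def by (simp add: topology_inverse')
qed

lemma openin_inverse_topology:
  "openin (inverse_topology X) =
     arbitrary union_of (\<lambda>U. \<exists>C. openin X C \<and> compactin X C \<and> U = topspace X - C)"
proof -
  have "openin (inverse_topology X) =
      arbitrary union_of (\<lambda>U. \<exists>C \<in> {C. openin X C \<and> compactin X C}. U = topspace X - C)"
    unfolding inverse_topology_def
    by (rule openin_closed_base_topology) (auto intro: compactin_Un)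
  then show ?thesis by (simp add: conj_assoc)
qed

lemma topspace_inverse_topology: "topspace (inverse_topology X) = topspace X"
proof
  show "topspace (inverse_topology X) \<subseteq> topspace X"
    using openin_topspace[of "inverse_topology X"]
    by (auto simp: openin_inverse_topology arbitrary_union_of_alt)
  have "openin (inverse_topology X) (topspace X)"
    unfolding openin_inverse_topology
    by (rule arbitrary_union_of_inc) (rule exI[of _ "{}"], simp)
  then show "topspace X \<subseteq> topspace (inverse_topology X)"
    by (rule openin_subset)
qed

context tt_category
begin

lemma supp_zero:
  assumes "zero_object K Z"
  shows "supp K Z = {}"
proof -
  have "Z \<in> P" if "P \<in> Spc K" for P
  proof -
    have "triangulated_subcategory K P"
      using that by (simp add: Spc_def prime_ideal_def tt_ideal_def)
    then show ?thesis
      using assms unfolding triangulated_subcategory_def by meson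
  qed
  then show ?thesis by (auto simp: supp_def)
qed

lemma supp_direct_sum:
  assumes "direct_sum K X Y W"
  shows "supp K W = supp K X \<union> supp K Y"
proof -
  have "W \<in> P \<longleftrightarrow> X \<in> P \<and> Y \<in> P" if "P \<in> Spc K" for P
  proof -
    have P: "tt_ideal K P" using that by (simp add: Spc_def prime_ideal_def)
    then have "W \<in> P \<Longrightarrow> X \<in> P \<and> Y \<in> P"
      using assms unfolding tt_ideal_def by meson
    moreover have "triangulated_subcategory K P" using P by (simp add: tt_ideal_def)
    then have "X \<in> P \<and> Y \<in> P \<Longrightarrow> W \<in> P"
      using assms unfolding triangulated_subcategory_def by meson
    ultimately show ?thesis by blast
  qed
  then show ?thesis by (auto simp: supp_def)
qed

lemma openin_Spc_topology:
  "openin (Spc_topology K) = arbitrary union_of (\<lambda>U. \<exists>X \<in> Ob K. U = Spc K - supp K X)"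
proof -
  have "openin (Spc_topology K) =
      arbitrary union_of (\<lambda>U. \<exists>C \<in> supp K ` Ob K. U = Spc K - C)"
    unfolding Spc_topology_def
  proof (rule openin_closed_base_topology)
    fix C D assume "C \<in> supp K ` Ob K" "D \<in> supp K ` Ob K"
    then obtain X Y where XY: "X \<in> Ob K" "Y \<in> Ob K" "C = supp K X" "D = supp K Y" by blast
    then obtain W where "direct_sum K X Y W" using direct_sum_exists by blast
    then show "C \<union> D \<in> supp K ` Ob K"
      using XY supp_direct_sum[of X Y W] by (auto simp: direct_sum_def)
  qed
  then show ?thesis by simp
qed

lemma topspace_Spc_topology: "topspace (Spc_topology K) = Spc K"
proof
  show "topspace (Spc_topology K) \<subseteq> Spc K"
    using openin_topspace[of "Spc_topology K"]
    by (auto simp: openin_Spc_topology arbitrary_union_of_alt)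
  obtain Z where "zero_object K Z" using zero_object_exists by blast
  then have "openin (Spc_topology K) (Spc K)"
    unfolding openin_Spc_topology
    by (intro arbitrary_union_of_inc bexI[of _ Z]) (auto simp: supp_zero zero_object_def)
  then show "Spc K \<subseteq> topspace (Spc_topology K)"
    by (rule openin_subset)
qed

end

end

theory Submission
  imports Defs
begin

text \<open>
  An ideal maximal among those avoiding a multiplicative set is prime, because the quotients
  \<open>{Y. Y \<otimes> B \<in> J}\<close> of an ideal are ideals. Hence the radical of an ideal is the intersection
  of the primes containing it, and the sets \<open>{P. X \<in> P}\<close> are exactly the quasi-compact open
  subsets of the spectrum. So the closed sets of the inverse topology are the sets of primes
  containing a given family of objects, and they correspond, with inclusion reversed, to the
  radical ideals; this makes (c) the ascending chain condition on radical ideals, which is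
  equivalent to (a). As in Cohen's theorem for commutative rings, a maximal radical ideal that
  is not finitely generated is prime, so (b) implies (a).
\<close>

section \<open>Preimages under exact functors\<close>

context category
begin

lemma isomorphic_sym:
  assumes "isomorphic K X Y"
  shows "isomorphic K Y X"
proof -
  obtain f g where "f \<in> Hom K X Y" "g \<in> Hom K Y X" "g \<cdot> f = Id K X" "f \<cdot> g = Id K Y"
    using assms by (auto simp: isomorphic_def is_iso_def Hom_def)
  then have "is_iso K g"
    by (auto simp: is_iso_def Hom_def)
  with \<open>g \<in> Hom K Y X\<close> show ?thesis
    unfolding isomorphic_def by blast
qed

lemma isomorphic_Ob:
  assumes "isomorphic K X Y"
  shows "X \<in> Ob K" "Y \<in> Ob K"
  using assms Dom_Ob Cod_Ob by (auto simp: isomorphic_def Hom_def)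

lemma endofunctor_isomorphic:
  assumes F: "endofunctor K Fo Fa" and iso: "isomorphic K X Y"
  shows "isomorphic K (Fo X) (Fo Y)"
proof -
  obtain f g where fg: "f \<in> Hom K X Y" "g \<in> Hom K Y X" "g \<cdot> f = Id K X" "f \<cdot> g = Id K Y"
    using iso by (auto simp: isomorphic_def is_iso_def Hom_def)
  have Ob: "X \<in> Ob K" "Y \<in> Ob K"
    using isomorphic_Ob[OF iso] by auto
  have "Fa f \<in> Hom K (Fo X) (Fo Y)" "Fa g \<in> Hom K (Fo Y) (Fo X)"
    using F fg Ob by (auto simp: endofunctor_def)
  moreover have "Fa g \<cdot> Fa f = Id K (Fo X)" "Fa f \<cdot> Fa g = Id K (Fo Y)"
    using F fg Ob unfolding endofunctor_def by metis+
  ultimately show ?thesis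
    by (auto simp: isomorphic_def is_iso_def Hom_def)
qed

end

context additive_category
begin

lemma Zero_Hom:
  assumes "X \<in> Ob K" "Y \<in> Ob K"
  shows "Zero K X Y \<in> Hom K X Y"
proof -
  interpret comm_group "Hom_group K X Y" using assms by (rule Hom_comm_group)
  show ?thesis using one_closed by (simp add: Hom_group_def)
qed

text \<open>Additivity of a functor speaks of sums only. The zero morphism equals its own double, so
  its image is an idempotent of the target Hom group, and a group has only the neutral one.\<close>

lemma additive_endofunctor_Zero:
  assumes F: "additive_endofunctor K Fo Fa" and Ob: "X \<in> Ob K" "Y \<in> Ob K"
  shows "Fa (Zero K X Y) = Zero K (Fo X) (Fo Y)"
proof -
  have FOb: "Fo X \<in> Ob K" "Fo Y \<in> Ob K"
    using F Ob by (auto simp: additive_endofunctor_def endofunctor_def)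
  interpret G: comm_group "Hom_group K X Y" using Ob by (rule Hom_comm_group)
  interpret H: comm_group "Hom_group K (Fo X) (Fo Y)" using FOb by (rule Hom_comm_group)
  have Z: "Zero K X Y \<in> Hom K X Y" using Ob by (rule Zero_Hom)
  then have FZ: "Fa (Zero K X Y) \<in> Hom K (Fo X) (Fo Y)"
    using F Ob by (auto simp: additive_endofunctor_def endofunctor_def)
  have "Zero K X Y \<uplus> Zero K X Y = Zero K X Y"
    using G.l_one[of "Zero K X Y"] Z by (simp add: Hom_group_def)
  then have "Fa (Zero K X Y) \<uplus> Fa (Zero K X Y) = Fa (Zero K X Y)"
    using F Ob Z unfolding additive_endofunctor_def by metis
  then show ?thesis
    using H.l_cancel_one[of "Fa (Zero K X Y)" "Fa (Zero K X Y)"] FZ by (simp add: Hom_group_def)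
qed

text \<open>A direct sum is described by equations between injections and projections, built from
  composition, addition, identities and zero morphisms. An additive functor carries such equations
  along.\<close>

lemma additive_endofunctor_direct_sum:
  assumes F: "additive_endofunctor K Fo Fa" and W: "direct_sum K X Y W"
  shows "direct_sum K (Fo X) (Fo Y) (Fo W)"
proof -
  have Ob: "X \<in> Ob K" "Y \<in> Ob K" "W \<in> Ob K"
    using W by (auto simp: direct_sum_def)
  obtain i j p q where h: "i \<in> Hom K X W" "j \<in> Hom K Y W" "p \<in> Hom K W X" "q \<in> Hom K W Y"
    and e: "p \<cdot> i = Id K X" "q \<cdot> j = Id K Y" "p \<cdot> j = Zero K Y X" "q \<cdot> i = Zero K X Y"
      "(i \<cdot> p) \<uplus> (j \<cdot> q) = Id K W"
    using W by (auto simp: direct_sum_def)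
  have E: "endofunctor K Fo Fa"
    using F by (simp add: additive_endofunctor_def)
  then have FOb: "Fo A \<in> Ob K" if "A \<in> Ob K" for A
    using that by (simp add: endofunctor_def)
  have FId: "Fa (Id K A) = Id K (Fo A)" if "A \<in> Ob K" for A
    using E that by (simp add: endofunctor_def)
  have FHom: "Fa f \<in> Hom K (Fo A) (Fo B)" if "A \<in> Ob K" "B \<in> Ob K" "f \<in> Hom K A B" for f A B
    using E that by (simp add: endofunctor_def)
  have FComp: "Fa g \<cdot> Fa f = Fa (g \<cdot> f)"
    if "A \<in> Ob K" "B \<in> Ob K" "C \<in> Ob K" "f \<in> Hom K A B" "g \<in> Hom K B C" for f g A B C
    using E that by (simp add: endofunctor_def)
  have "i \<cdot> p \<in> Hom K W W" "j \<cdot> q \<in> Hom K W W"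
    using h Comp_Hom by auto
  then have "Fa (i \<cdot> p) \<uplus> Fa (j \<cdot> q) = Id K (Fo W)"
    using F Ob e(5) FId unfolding additive_endofunctor_def by metis
  moreover have "Fa i \<cdot> Fa p = Fa (i \<cdot> p)" "Fa j \<cdot> Fa q = Fa (j \<cdot> q)"
    using FComp h Ob by blast+
  ultimately have 1: "(Fa i \<cdot> Fa p) \<uplus> (Fa j \<cdot> Fa q) = Id K (Fo W)"
    by simp
  have 2: "Fa p \<cdot> Fa i = Id K (Fo X)" "Fa q \<cdot> Fa j = Id K (Fo Y)"
    "Fa p \<cdot> Fa j = Zero K (Fo Y) (Fo X)" "Fa q \<cdot> Fa i = Zero K (Fo X) (Fo Y)"
    using FComp[OF Ob(1,3,1) h(1,3)] FComp[OF Ob(2,3,2) h(2,4)] FComp[OF Ob(2,3,1) h(2,3)]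
      FComp[OF Ob(1,3,2) h(1,4)] e FId Ob additive_endofunctor_Zero[OF F] by auto
  have 3: "Fa i \<in> Hom K (Fo X) (Fo W)" "Fa j \<in> Hom K (Fo Y) (Fo W)"
    "Fa p \<in> Hom K (Fo W) (Fo X)" "Fa q \<in> Hom K (Fo W) (Fo Y)"
    using FHom h Ob by auto
  show ?thesis
    unfolding direct_sum_def using FOb Ob 1 2 3 by blast
qed

end

context triangulated_category
begin

text \<open>
  That the preimage contains the zero objects follows by applying the functor to the triangle
  \<open>A \<longrightarrow> A \<longrightarrow> 0 \<longrightarrow> \<Sigma>A\<close>, for any one object \<open>A\<close> of the preimage.
\<close>

lemma triangulated_subcategory_preimage:
  assumes F: "exact_endofunctor K Fo Fa" and S: "triangulated_subcategory K S"
    and A: "A \<in> Ob K" "Fo A \<in> S"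
  shows "triangulated_subcategory K {X \<in> Ob K. Fo X \<in> S}"
proof -
  have add: "additive_endofunctor K Fo Fa" and E: "endofunctor K Fo Fa"
    using F by (auto simp: exact_endofunctor_def additive_endofunctor_def)
  have sum: "\<And>X Y W. \<lbrakk>X \<in> S; Y \<in> S; direct_sum K X Y W\<rbrakk> \<Longrightarrow> W \<in> S"
    and iso': "\<And>X Y. \<lbrakk>X \<in> S; Y \<in> Ob K; isomorphic K X Y\<rbrakk> \<Longrightarrow> Y \<in> S"
    and shift: "\<And>X. X \<in> Ob K \<Longrightarrow> ShO K X \<in> S \<longleftrightarrow> X \<in> S"
    and cone: "\<And>f g h. \<lbrakk>(f, g, h) \<in> Tri K; Dom K f \<in> S; Cod K f \<in> S\<rbrakk> \<Longrightarrow> Cod K g \<in> S"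
    using S unfolding triangulated_subcategory_def by metis+
  have iso: "Y \<in> S" if "X \<in> S" "isomorphic K X Y" for X Y
    using iso' isomorphic_Ob(2) that by blast
  obtain \<phi> where \<phi>': "\<forall>X\<in>Ob K. \<phi> X \<in> Hom K (Fo (ShO K X)) (ShO K (Fo X)) \<and> is_iso K (\<phi> X)"
    and Tri': "\<forall>f g h. (f, g, h) \<in> Tri K \<longrightarrow> (Fa f, Fa g, \<phi> (Dom K f) \<cdot> Fa h) \<in> Tri K"
    using F unfolding exact_endofunctor_def by (elim conjE exE)
  have \<phi>: "isomorphic K (Fo (ShO K X)) (ShO K (Fo X))" if "X \<in> Ob K" for X
    using \<phi>' that unfolding isomorphic_def by blast
  have Tri: "(Fa f, Fa g, \<phi> (Dom K f) \<cdot> Fa h) \<in> Tri K" if "(f, g, h) \<in> Tri K" for f g h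
    using Tri' that by (elim allE impE)
  have FOb: "Fo X \<in> Ob K" if "X \<in> Ob K" for X
    using E that by (simp add: endofunctor_def)
  have FDom: "Dom K (Fa f) = Fo (Dom K f)" "Cod K (Fa f) = Fo (Cod K f)" if "f \<in> Arr K" for f
  proof -
    have "f \<in> Hom K (Dom K f) (Cod K f)" "Dom K f \<in> Ob K" "Cod K f \<in> Ob K"
      using that Dom_Ob Cod_Ob by (auto simp: Hom_def)
    then have "Fa f \<in> Hom K (Fo (Dom K f)) (Fo (Cod K f))"
      using E unfolding endofunctor_def by blast
    then show "Dom K (Fa f) = Fo (Dom K f)" "Cod K (Fa f) = Fo (Cod K f)"
      by (auto simp: Hom_def)
  qed
  have Fcone: "Fo (Cod K g) \<in> S" "Cod K g \<in> Ob K"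
    if t: "(f, g, h) \<in> Tri K" and "Fo (Dom K f) \<in> S" "Fo (Cod K f) \<in> S" for f g h
  proof -
    have "f \<in> Arr K" "g \<in> Arr K"
      using Tri_is_triangle[OF t] by (auto simp: is_triangle_def)
    then show "Fo (Cod K g) \<in> S" "Cod K g \<in> Ob K"
      using cone[OF Tri[OF t]] FDom that Cod_Ob by auto
  qed
  show ?thesis
    unfolding triangulated_subcategory_def
  proof (intro conjI allI ballI impI)
    fix Z assume Z: "zero_object K Z"
    then have "Z \<in> Ob K" by (simp add: zero_object_def)
    then have "Zero K A Z \<in> Hom K A Z" "Id K A \<in> Hom K A A"
      using A Zero_Hom Id_Hom by auto
    then show "Z \<in> {X \<in> Ob K. Fo X \<in> S}"
      using Fcone[OF TR1_id[OF A(1) Z]] A by (auto simp: Hom_def)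
  next
    fix X Y W
    assume "X \<in> {X \<in> Ob K. Fo X \<in> S} \<and> Y \<in> {X \<in> Ob K. Fo X \<in> S} \<and> direct_sum K X Y W"
    then have "Fo X \<in> S" "Fo Y \<in> S" and W: "direct_sum K X Y W" by simp_all
    then have "Fo W \<in> S"
      using sum additive_endofunctor_direct_sum[OF add W] by blast
    moreover have "W \<in> Ob K" using W by (simp add: direct_sum_def)
    ultimately show "W \<in> {X \<in> Ob K. Fo X \<in> S}" by simp
  next
    fix X Y assume X: "X \<in> {X \<in> Ob K. Fo X \<in> S}" and Y: "Y \<in> Ob K" "isomorphic K X Y"
    then have "Fo Y \<in> S"
      using iso[OF _ endofunctor_isomorphic[OF E Y(2)]] by simp
    with Y show "Y \<in> {X \<in> Ob K. Fo X \<in> S}" by simp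
  next
    fix X assume X: "X \<in> Ob K"
    then have "ShO K X \<in> Ob K"
      using shift_autoequivalence by (auto simp: autoequivalence_def endofunctor_def)
    \<comment> \<open>The functor commutes with the suspension only up to isomorphism, so membership
      in \<open>S\<close> is transported along that isomorphism in both directions.\<close>
    moreover have "Fo (ShO K X) \<in> S \<longleftrightarrow> Fo X \<in> S"
      using iso[OF _ \<phi>[OF X]] iso[OF _ isomorphic_sym[OF \<phi>[OF X]]] shift[OF FOb[OF X]] by blast
    ultimately show "ShO K X \<in> {X \<in> Ob K. Fo X \<in> S} \<longleftrightarrow> X \<in> {X \<in> Ob K. Fo X \<in> S}"
      using X by blast
  next
    fix f g h
    assume "(f, g, h) \<in> Tri K \<and> Dom K f \<in> {X \<in> Ob K. Fo X \<in> S} \<and> Cod K f \<in> {X \<in> Ob K. Fo X \<in> S}"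
    then show "Cod K g \<in> {X \<in> Ob K. Fo X \<in> S}"
      using Fcone by auto
  qed blast
qed

end

section \<open>Ideals and primes\<close>

context tt_category
begin

section \<open>Elementary closure properties of ideals\<close>

lemma tt_ideal_triangulated: "tt_ideal K I \<Longrightarrow> triangulated_subcategory K I"
  unfolding tt_ideal_def by (elim conjE)

lemma tt_ideal_Ob_subset: "tt_ideal K I \<Longrightarrow> I \<subseteq> Ob K"
  unfolding tt_ideal_def triangulated_subcategory_def by (elim conjE)

lemma tt_ideal_isomorphic:
  assumes "tt_ideal K I" "isomorphic K X Y" "X \<in> I"
  shows "Y \<in> I"
proof -
  have "\<forall>X\<in>I. \<forall>Y\<in>Ob K. isomorphic K X Y \<longrightarrow> Y \<in> I"
    using assms(1) unfolding tt_ideal_def triangulated_subcategory_def by (elim conjE)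
  then show ?thesis using assms isomorphic_Ob(2) by blast
qed

lemma tt_ideal_isomorphic_iff: "\<lbrakk>tt_ideal K I; isomorphic K X Y\<rbrakk> \<Longrightarrow> X \<in> I \<longleftrightarrow> Y \<in> I"
  using tt_ideal_isomorphic[of I X Y] tt_ideal_isomorphic[of I Y X] isomorphic_sym[of X Y] by argo

lemma tt_ideal_tensor:
  assumes "tt_ideal K I" "X \<in> I" "Y \<in> Ob K"
  shows "X \<odot> Y \<in> I" "Y \<odot> X \<in> I"
proof -
  have "\<forall>X\<in>I. \<forall>Y\<in>Ob K. X \<odot> Y \<in> I \<and> Y \<odot> X \<in> I"
    using assms(1) unfolding tt_ideal_def by (elim conjE)
  then show "X \<odot> Y \<in> I" "Y \<odot> X \<in> I" using assms(2,3) by blast+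
qed

lemma isomorphic_braid: "\<lbrakk>X \<in> Ob K; Y \<in> Ob K\<rbrakk> \<Longrightarrow> isomorphic K (X \<odot> Y) (Y \<odot> X)"
  unfolding isomorphic_def using Braid_iso[of X Y] by blast

lemma isomorphic_assoc:
  "\<lbrakk>X \<in> Ob K; Y \<in> Ob K; Z \<in> Ob K\<rbrakk> \<Longrightarrow> isomorphic K ((X \<odot> Y) \<odot> Z) (X \<odot> (Y \<odot> Z))"
  unfolding isomorphic_def using Assoc_iso[of X Y Z] by blast

lemma tt_ideal_braid:
  "\<lbrakk>tt_ideal K I; X \<in> Ob K; Y \<in> Ob K\<rbrakk> \<Longrightarrow> X \<odot> Y \<in> I \<longleftrightarrow> Y \<odot> X \<in> I"
  by (rule tt_ideal_isomorphic_iff[OF _ isomorphic_braid])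

lemma tt_ideal_assoc:
  "\<lbrakk>tt_ideal K I; X \<in> Ob K; Y \<in> Ob K; Z \<in> Ob K\<rbrakk>
    \<Longrightarrow> (X \<odot> Y) \<odot> Z \<in> I \<longleftrightarrow> X \<odot> (Y \<odot> Z) \<in> I"
  by (rule tt_ideal_isomorphic_iff[OF _ isomorphic_assoc])

lemma tt_ideal_Unit:
  assumes I: "tt_ideal K I" and "Unit K \<in> I"
  shows "I = Ob K"
proof
  show "I \<subseteq> Ob K" using I by (rule tt_ideal_Ob_subset)
  show "Ob K \<subseteq> I"
  proof
    fix X assume X: "X \<in> Ob K"
    then have "isomorphic K (Unit K \<odot> X) X"
      unfolding isomorphic_def using LUnit_iso[of X] by blast
    then show "X \<in> I"
      using tt_ideal_isomorphic[OF I] tt_ideal_tensor(1)[OF assms X] by simp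
  qed
qed

lemma tt_idealI:
  assumes "I \<subseteq> Ob K"
    and "\<And>Z. zero_object K Z \<Longrightarrow> Z \<in> I"
    and "\<And>X Y W. \<lbrakk>X \<in> I; Y \<in> I; direct_sum K X Y W\<rbrakk> \<Longrightarrow> W \<in> I"
    and "\<And>X Y. \<lbrakk>X \<in> I; isomorphic K X Y\<rbrakk> \<Longrightarrow> Y \<in> I"
    and "\<And>X. X \<in> Ob K \<Longrightarrow> ShO K X \<in> I \<longleftrightarrow> X \<in> I"
    and "\<And>f g h. \<lbrakk>(f, g, h) \<in> Tri K; Dom K f \<in> I; Cod K f \<in> I\<rbrakk> \<Longrightarrow> Cod K g \<in> I"
    and "\<And>X Y W. \<lbrakk>direct_sum K X Y W; W \<in> I\<rbrakk> \<Longrightarrow> X \<in> I \<and> Y \<in> I"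
    and "\<And>X Y. \<lbrakk>X \<in> I; Y \<in> Ob K\<rbrakk> \<Longrightarrow> X \<odot> Y \<in> I \<and> Y \<odot> X \<in> I"
  shows "tt_ideal K I"
proof -
  have "triangulated_subcategory K I"
    unfolding triangulated_subcategory_def
  proof (intro conjI allI ballI impI; (elim conjE)?)
  qed (rule assms; assumption)+
  then show ?thesis
    unfolding tt_ideal_def using assms(7,8) by blast
qed

lemma tt_ideal_zero:
  assumes "tt_ideal K I" "zero_object K Z"
  shows "Z \<in> I"
proof -
  have "\<forall>Z. zero_object K Z \<longrightarrow> Z \<in> I"
    using assms(1) unfolding tt_ideal_def triangulated_subcategory_def by (elim conjE)
  then show ?thesis using assms(2) by blast
qed

lemma tt_ideal_direct_sum:
  assumes "tt_ideal K I" "direct_sum K X Y W"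
  shows "W \<in> I \<longleftrightarrow> X \<in> I \<and> Y \<in> I"
proof -
  have "\<forall>X Y W. direct_sum K X Y W \<and> W \<in> I \<longrightarrow> X \<in> I \<and> Y \<in> I"
    using assms(1) unfolding tt_ideal_def by (elim conjE)
  moreover have "\<forall>X Y W. X \<in> I \<and> Y \<in> I \<and> direct_sum K X Y W \<longrightarrow> W \<in> I"
    using assms(1) unfolding tt_ideal_def triangulated_subcategory_def by (elim conjE)
  ultimately show ?thesis using assms(2) by blast
qed

lemma tt_ideal_shift:
  assumes "tt_ideal K I" "X \<in> Ob K"
  shows "ShO K X \<in> I \<longleftrightarrow> X \<in> I"
proof -
  have "\<forall>X\<in>Ob K. ShO K X \<in> I \<longleftrightarrow> X \<in> I"
    using assms(1) unfolding tt_ideal_def triangulated_subcategory_def by (elim conjE)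
  then show ?thesis using assms(2) by blast
qed

lemma tt_ideal_cone:
  assumes "tt_ideal K I" "(f, g, h) \<in> Tri K" "Dom K f \<in> I" "Cod K f \<in> I"
  shows "Cod K g \<in> I"
proof -
  have "\<forall>f g h. (f, g, h) \<in> Tri K \<and> Dom K f \<in> I \<and> Cod K f \<in> I \<longrightarrow> Cod K g \<in> I"
    using assms(1) unfolding tt_ideal_def triangulated_subcategory_def by (elim conjE)
  then show ?thesis using assms(2-4) by blast
qed

section \<open>New ideals from old: intersections, unions of chains, quotients\<close>

lemma tt_ideal_Ob: "tt_ideal K (Ob K)"
proof (rule tt_idealI)
  show "Cod K g \<in> Ob K" if "(f, g, h) \<in> Tri K" for f g h
    using Tri_is_triangle[OF that] Cod_Ob[of g] unfolding is_triangle_def by simp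
  show "ShO K X \<in> Ob K \<longleftrightarrow> X \<in> Ob K" if "X \<in> Ob K" for X
    using that shift_autoequivalence by (auto simp: autoequivalence_def endofunctor_def)
qed (auto simp: zero_object_def direct_sum_def TenO_Ob isomorphic_Ob)

lemma tt_ideal_nonempty:
  assumes "tt_ideal K I"
  obtains X where "X \<in> I"
  using assms zero_object_exists tt_ideal_zero by blast

text \<open>The family must be nonempty because the empty intersection is the whole type, which may
  be larger than \<open>Ob K\<close>.\<close>

lemma tt_ideal_Inter:
  assumes "\<I> \<noteq> {}" and ideal: "\<And>I. I \<in> \<I> \<Longrightarrow> tt_ideal K I"
  shows "tt_ideal K (\<Inter>\<I>)"
proof (rule tt_idealI)
  show "\<Inter>\<I> \<subseteq> Ob K" using assms tt_ideal_Ob_subset by blast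
  show "Z \<in> \<Inter>\<I>" if "zero_object K Z" for Z
    using that ideal tt_ideal_zero by blast
  show "W \<in> \<Inter>\<I>" if "X \<in> \<Inter>\<I>" "Y \<in> \<Inter>\<I>" "direct_sum K X Y W" for X Y W
    using that ideal tt_ideal_direct_sum by blast
  show "Y \<in> \<Inter>\<I>" if "X \<in> \<Inter>\<I>" "isomorphic K X Y" for X Y
    using that ideal tt_ideal_isomorphic by blast
  show "ShO K X \<in> \<Inter>\<I> \<longleftrightarrow> X \<in> \<Inter>\<I>" if "X \<in> Ob K" for X
    using that ideal tt_ideal_shift by blast
  show "Cod K g \<in> \<Inter>\<I>"
    if "(f, g, h) \<in> Tri K" "Dom K f \<in> \<Inter>\<I>" "Cod K f \<in> \<Inter>\<I>" for f g h
    using that ideal tt_ideal_cone by blast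
  show "X \<in> \<Inter>\<I> \<and> Y \<in> \<Inter>\<I>" if "direct_sum K X Y W" "W \<in> \<Inter>\<I>" for X Y W
    using that ideal tt_ideal_direct_sum by blast
  show "X \<odot> Y \<in> \<Inter>\<I> \<and> Y \<odot> X \<in> \<Inter>\<I>" if "X \<in> \<Inter>\<I>" "Y \<in> Ob K" for X Y
    using that ideal tt_ideal_tensor by blast
qed

text \<open>Each closure condition has at most two members of the ideal among its premises, and in a
  chain any two members of the union lie in a common ideal of the chain.\<close>

lemma tt_ideal_Union_chain:
  assumes "\<I> \<noteq> {}" and ideal: "\<And>I. I \<in> \<I> \<Longrightarrow> tt_ideal K I"
    and chain: "\<And>I J. \<lbrakk>I \<in> \<I>; J \<in> \<I>\<rbrakk> \<Longrightarrow> I \<subseteq> J \<or> J \<subseteq> I"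
  shows "tt_ideal K (\<Union>\<I>)"
proof (rule tt_idealI)
  have two: "\<exists>I\<in>\<I>. X \<in> I \<and> Y \<in> I" if "X \<in> \<Union>\<I>" "Y \<in> \<Union>\<I>" for X Y
    using that chain by blast
  show "\<Union>\<I> \<subseteq> Ob K" using ideal tt_ideal_Ob_subset by blast
  show "Z \<in> \<Union>\<I>" if "zero_object K Z" for Z
    using that assms(1) ideal tt_ideal_zero by blast
  show "W \<in> \<Union>\<I>" if "X \<in> \<Union>\<I>" "Y \<in> \<Union>\<I>" "direct_sum K X Y W" for X Y W
    using two[OF that(1,2)] that(3) ideal tt_ideal_direct_sum by blast
  show "Y \<in> \<Union>\<I>" if "X \<in> \<Union>\<I>" "isomorphic K X Y" for X Y
    using that ideal tt_ideal_isomorphic by blast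
  show "ShO K X \<in> \<Union>\<I> \<longleftrightarrow> X \<in> \<Union>\<I>" if "X \<in> Ob K" for X
    using that ideal tt_ideal_shift by blast
  show "Cod K g \<in> \<Union>\<I>"
    if "(f, g, h) \<in> Tri K" "Dom K f \<in> \<Union>\<I>" "Cod K f \<in> \<Union>\<I>" for f g h
    using two[OF that(2,3)] that(1) ideal tt_ideal_cone by blast
  show "X \<in> \<Union>\<I> \<and> Y \<in> \<Union>\<I>" if "direct_sum K X Y W" "W \<in> \<Union>\<I>" for X Y W
    using that ideal tt_ideal_direct_sum by blast
  show "X \<odot> Y \<in> \<Union>\<I> \<and> Y \<odot> X \<in> \<Union>\<I>" if "X \<in> \<Union>\<I>" "Y \<in> Ob K" for X Y
    using that ideal tt_ideal_tensor by blast
qed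

lemma tt_ideal_ideal_generated: "F \<subseteq> Ob K \<Longrightarrow> tt_ideal K (ideal_generated K F)"
  unfolding ideal_generated_def using tt_ideal_Ob by (intro tt_ideal_Inter) auto

lemma ideal_generated_subset_iff:
  "tt_ideal K I \<Longrightarrow> ideal_generated K F \<subseteq> I \<longleftrightarrow> F \<subseteq> I"
  unfolding ideal_generated_def by blast

text \<open>This is the preimage of \<open>J\<close> under the exact functor that tensors with
  \<open>B\<close>. Any object of \<open>J\<close> serves as the object that the preimage lemma asks
  for, since \<open>J\<close> absorbs tensor products. Closure under tensoring comes from
  associativity and the braiding.\<close>

lemma tt_ideal_quotient:
  assumes J: "tt_ideal K J" and B: "B \<in> Ob K"
  shows "tt_ideal K {X \<in> Ob K. X \<odot> B \<in> J}"
proof -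
  have F: "exact_endofunctor K (\<lambda>Y. Y \<odot> B) (\<lambda>f. f \<oslash> Id K B)"
    using B by (rule tensor_exact_left)
  then have add: "additive_endofunctor K (\<lambda>Y. Y \<odot> B) (\<lambda>f. f \<oslash> Id K B)"
    by (simp add: exact_endofunctor_def)
  then have endo: "endofunctor K (\<lambda>Y. Y \<odot> B) (\<lambda>f. f \<oslash> Id K B)"
    by (simp add: additive_endofunctor_def)
  obtain A where "A \<in> J" using tt_ideal_nonempty[OF J] .
  then have "A \<in> Ob K" "A \<odot> B \<in> J"
    using J B tt_ideal_Ob_subset tt_ideal_tensor by auto
  then have tri: "triangulated_subcategory K {X \<in> Ob K. X \<odot> B \<in> J}"
    by (rule triangulated_subcategory_preimage[OF F tt_ideal_triangulated[OF J]])
  have summand: "X \<in> {X \<in> Ob K. X \<odot> B \<in> J} \<and> Y \<in> {X \<in> Ob K. X \<odot> B \<in> J}"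
    if "direct_sum K X Y W \<and> W \<in> {X \<in> Ob K. X \<odot> B \<in> J}" for X Y W
  proof -
    have W: "direct_sum K X Y W" "W \<odot> B \<in> J" using that by auto
    then have "X \<in> Ob K" "Y \<in> Ob K" unfolding direct_sum_def by blast+
    with tt_ideal_direct_sum[OF J additive_endofunctor_direct_sum[OF add W(1)]] W(2)
    show ?thesis by simp
  qed
  have tensor: "X \<odot> Y \<in> {X \<in> Ob K. X \<odot> B \<in> J} \<and> Y \<odot> X \<in> {X \<in> Ob K. X \<odot> B \<in> J}"
    if "X \<in> {X \<in> Ob K. X \<odot> B \<in> J}" and Y: "Y \<in> Ob K" for X Y
  proof -
    have X: "X \<in> Ob K" "X \<odot> B \<in> J" using that by auto
    have "Y \<odot> (X \<odot> B) \<in> J"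
      using tt_ideal_tensor(2)[OF J X(2) Y] .
    then have 1: "(Y \<odot> X) \<odot> B \<in> J"
      using tt_ideal_assoc[OF J Y X(1) B] by simp
    \<comment> \<open>Tensoring the braiding of \<open>Y\<close> and \<open>X\<close> with
      \<open>B\<close> gives the product on the other side without a second use of
      associativity.\<close>
    have "isomorphic K ((Y \<odot> X) \<odot> B) ((X \<odot> Y) \<odot> B)"
      by (rule endofunctor_isomorphic[OF endo isomorphic_braid[OF Y X(1)]])
    with 1 have "(X \<odot> Y) \<odot> B \<in> J"
      using tt_ideal_isomorphic[OF J] by simp
    with 1 show ?thesis using X Y TenO_Ob by simp
  qed
  show ?thesis
    unfolding tt_ideal_def using tri summand tensor by blast
qed

section \<open>Prime ideals and their existence\<close>

lemma prime_ideal_tt_ideal: "prime_ideal K P \<Longrightarrow> tt_ideal K P"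
  by (simp add: prime_ideal_def)

lemma prime_ideal_tensor_iff:
  assumes P: "prime_ideal K P" and Ob: "X \<in> Ob K" "Y \<in> Ob K"
  shows "X \<odot> Y \<in> P \<longleftrightarrow> X \<in> P \<or> Y \<in> P"
proof
  show "X \<in> P \<or> Y \<in> P" if "X \<odot> Y \<in> P"
    using P Ob that by (simp add: prime_ideal_def)
  show "X \<odot> Y \<in> P" if "X \<in> P \<or> Y \<in> P"
    using that tt_ideal_tensor(1)[OF prime_ideal_tt_ideal[OF P], of X Y]
      tt_ideal_tensor(2)[OF prime_ideal_tt_ideal[OF P], of Y X] Ob by argo
qed

lemma Unit_notin_prime: "prime_ideal K P \<Longrightarrow> Unit K \<notin> P"
  using tt_ideal_Unit[of P] by (auto simp: prime_ideal_def)

text \<open>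
  The closure of \<open>S\<close> under tensor products is only required up to passing to an object of \<open>S\<close>
  contained in every ideal containing the product; this covers the powers of an object, which
  are multiplicative only up to isomorphism.
\<close>

lemma prime_avoiding_multiplicative:
  assumes I: "tt_ideal K I" and S: "S \<subseteq> Ob K" "S \<noteq> {}" "I \<inter> S = {}"
    and mult: "\<And>a b. \<lbrakk>a \<in> S; b \<in> S\<rbrakk> \<Longrightarrow> \<exists>c\<in>S. \<forall>J. tt_ideal K J \<longrightarrow> a \<odot> b \<in> J \<longrightarrow> c \<in> J"
  obtains P where "prime_ideal K P" "I \<subseteq> P" "P \<inter> S = {}"
proof -
  let ?A = "{J. tt_ideal K J \<and> I \<subseteq> J \<and> J \<inter> S = {}}"
  have "\<Union>C \<in> ?A" if "C \<noteq> {}" "subset.chain ?A C" for C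
  proof -
    have C: "C \<subseteq> ?A" and chain: "\<And>I J. \<lbrakk>I \<in> C; J \<in> C\<rbrakk> \<Longrightarrow> I \<subseteq> J \<or> J \<subseteq> I"
      using that unfolding subset.chain_def by blast+
    have "tt_ideal K (\<Union>C)"
    proof (rule tt_ideal_Union_chain)
      show "I \<subseteq> J \<or> J \<subseteq> I" if "I \<in> C" "J \<in> C" for I J using that by (rule chain)
    qed (use C \<open>C \<noteq> {}\<close> in auto)
    moreover have "I \<subseteq> \<Union>C" "\<Union>C \<inter> S = {}" using C \<open>C \<noteq> {}\<close> by blast+
    ultimately show ?thesis by simp
  qed
  moreover have "?A \<noteq> {}" using I S by blast
  ultimately obtain P where P: "tt_ideal K P" "I \<subseteq> P" "P \<inter> S = {}"
    and max: "\<And>J. J \<in> ?A \<Longrightarrow> P \<subseteq> J \<Longrightarrow> J = P"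
    using subset_Zorn_nonempty[of ?A] by auto
  have bigger: "ideal_generated K (insert X P) \<inter> S \<noteq> {}" if "X \<in> Ob K" "X \<notin> P" for X
  proof
    have F: "insert X P \<subseteq> Ob K"
      using that(1) tt_ideal_Ob_subset[OF P(1)] by simp
    have sub: "insert X P \<subseteq> ideal_generated K (insert X P)"
      using ideal_generated_subset_iff[OF tt_ideal_ideal_generated[OF F]] by (rule iffD1) simp
    assume "ideal_generated K (insert X P) \<inter> S = {}"
    then have "ideal_generated K (insert X P) = P"
      using tt_ideal_ideal_generated[OF F] P(2) sub by (intro max) auto
    then show False using that sub by blast
  qed
  have "X \<in> P \<or> Y \<in> P" if X: "X \<in> Ob K" and Y: "Y \<in> Ob K" and XY: "X \<odot> Y \<in> P" for X Y
  proof (rule ccontr)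
    assume "\<not> (X \<in> P \<or> Y \<in> P)"
    then obtain a b where a: "a \<in> S" "a \<in> ideal_generated K (insert X P)"
      and b: "b \<in> S" "b \<in> ideal_generated K (insert Y P)"
      using bigger[OF X] bigger[OF Y] by blast
    have Ob: "a \<in> Ob K" "b \<in> Ob K" using a(1) b(1) S(1) by blast+
    \<comment> \<open>This is used for two quotients of \<open>P\<close> in turn. The quotient by
      \<open>Y\<close> contains \<open>P\<close> and \<open>X\<close>, hence \<open>a\<close>; after
      a swap, the quotient by \<open>a\<close> contains \<open>P\<close> and \<open>Y\<close>, hence
      \<open>b\<close>. So the product of \<open>a\<close> and \<open>b\<close> lies in
      \<open>P\<close>, which forces \<open>P\<close> to meet \<open>S\<close>.\<close>
    have sub: "insert Z P \<subseteq> {V \<in> Ob K. V \<odot> W \<in> P}"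
      if "Z \<in> Ob K" "W \<in> Ob K" "Z \<odot> W \<in> P" for Z W
      using that tt_ideal_Ob_subset[OF P(1)] tt_ideal_tensor(1)[OF P(1) _ that(2)] by auto
    have "ideal_generated K (insert X P) \<subseteq> {Z \<in> Ob K. Z \<odot> Y \<in> P}"
      by (rule iffD2[OF ideal_generated_subset_iff[OF tt_ideal_quotient[OF P(1) Y]] sub[OF X Y XY]])
    then have "a \<odot> Y \<in> P" using a(2) by blast
    then have "Y \<odot> a \<in> P" using tt_ideal_braid[OF P(1) Ob(1) Y] by simp
    note Ya = sub[OF Y Ob(1) this]
    have "ideal_generated K (insert Y P) \<subseteq> {Z \<in> Ob K. Z \<odot> a \<in> P}"
      by (rule iffD2[OF ideal_generated_subset_iff[OF tt_ideal_quotient[OF P(1) Ob(1)]] Ya])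
    then have "b \<odot> a \<in> P" using b(2) by blast
    then have "a \<odot> b \<in> P" using tt_ideal_braid[OF P(1) Ob] by simp
    then obtain c where "c \<in> S" "c \<in> P" using mult[OF a(1) b(1)] P(1) by auto
    then show False using P(3) by blast
  qed
  moreover have "P \<noteq> Ob K" using P(3) S(1,2) by blast
  ultimately have "prime_ideal K P" using P(1) unfolding prime_ideal_def by blast
  then show thesis using P(2,3) by (rule that)
qed

section \<open>Tensor powers, and the radical as an intersection of primes\<close>

lemma tensor_power_Suc: "n \<ge> 1 \<Longrightarrow> tensor_power K X (Suc n) = tensor_power K X n \<odot> X"
  by (cases n) auto

lemma tensor_power_Ob:
  assumes "X \<in> Ob K"
  shows "tensor_power K X n \<in> Ob K"
proof (induction n)
  case (Suc n)
  then show ?case using assms TenO_Ob by (cases n) auto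
qed (simp add: Unit_Ob)

text \<open>Powers are bracketed to the left, so they multiply only up to associativity. The
  induction on \<open>n\<close> splits off one factor \<open>X\<close> by replacing \<open>J\<close>
  with its quotient by \<open>X\<close>; this is why \<open>J\<close> is arbitrary in the
  induction.\<close>

lemma tensor_power_add_in_ideal:
  assumes "X \<in> Ob K" "m \<ge> 1" "n \<ge> 1" "tt_ideal K J"
    and "tensor_power K X m \<odot> tensor_power K X n \<in> J"
  shows "tensor_power K X (m + n) \<in> J"
  using assms(3-5)
proof (induction n arbitrary: J rule: nat_induct_at_least)
  case base
  then show ?case using assms(2) tensor_power_Suc by simp
next
  case (Suc n)
  have "(tensor_power K X m \<odot> tensor_power K X n) \<odot> X \<in> J"
    using Suc.prems Suc.hyps tt_ideal_assoc tensor_power_Suc assms(1) tensor_power_Ob by simp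
  then have "tensor_power K X (m + n) \<in> {Y \<in> Ob K. Y \<odot> X \<in> J}"
    using tensor_power_Ob TenO_Ob assms(1) Suc.prems
    by (intro Suc.IH tt_ideal_quotient) auto
  then show ?case using tensor_power_Suc Suc.hyps by simp
qed

lemma tensor_power_in_prime:
  assumes P: "prime_ideal K P" and X: "X \<in> Ob K" and "n \<ge> 1" "tensor_power K X n \<in> P"
  shows "X \<in> P"
  using assms(3,4)
proof (induction n rule: nat_induct_at_least)
  case (Suc n)
  then show ?case
    using P X tensor_power_Suc prime_ideal_tensor_iff tensor_power_Ob by metis
qed simp

text \<open>The counterpart of the zero locus V(F) in algebraic geometry. For a single object it is
  the complement of the support, hence open in the spectrum; for arbitrary sets of objects these
  turn out to be the closed sets of the inverse topology.\<close>

definition primes_over :: "'o set \<Rightarrow> 'o set set" where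
  "primes_over F = {P \<in> Spc K. F \<subseteq> P}"

text \<open>For a set of objects this is the radical of the ideal it generates, expressed without
  powers or generated ideals. Bounding it by \<open>Ob K\<close> gives the right value when no prime
  contains \<open>F\<close>.\<close>

definition prime_radical :: "'o set \<Rightarrow> 'o set" where
  "prime_radical F = {X \<in> Ob K. \<forall>P \<in> primes_over F. X \<in> P}"

text \<open>A prime containing a power of \<open>X\<close> contains \<open>X\<close>. Conversely, if
  no positive power of \<open>X\<close> lies in \<open>I\<close>, these powers form a multiplicative
  set in the weak sense above, and some prime over \<open>I\<close> avoids them all, in particular
  \<open>X\<close>.\<close>

lemma tt_radical_eq_prime_radical:
  assumes I: "tt_ideal K I"
  shows "tt_radical K I = prime_radical I"
proof
  show "tt_radical K I \<subseteq> prime_radical I"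
    using tensor_power_in_prime
    unfolding tt_radical_def prime_radical_def primes_over_def Spc_def by blast
  show "prime_radical I \<subseteq> tt_radical K I"
  proof
    fix X assume X: "X \<in> prime_radical I"
    then have Ob: "X \<in> Ob K" by (simp add: prime_radical_def)
    show "X \<in> tt_radical K I"
    proof (rule ccontr)
      assume n: "X \<notin> tt_radical K I"
      let ?S = "tensor_power K X ` {1..}"
      obtain P where P: "prime_ideal K P" "I \<subseteq> P" "P \<inter> ?S = {}"
      proof (rule prime_avoiding_multiplicative[OF I, of ?S])
        show "?S \<subseteq> Ob K" using Ob tensor_power_Ob by blast
        show "I \<inter> ?S = {}" using n Ob by (auto simp: tt_radical_def)
        fix a b assume "a \<in> ?S" "b \<in> ?S"
        then obtain m n where mn: "m \<ge> 1" "n \<ge> 1" "a = tensor_power K X m" "b = tensor_power K X n"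
          by auto
        then show "\<exists>c\<in>?S. \<forall>J. tt_ideal K J \<longrightarrow> a \<odot> b \<in> J \<longrightarrow> c \<in> J"
          using tensor_power_add_in_ideal[OF Ob mn(1,2)]
          by (intro bexI[of _ "tensor_power K X (m + n)"]) auto
      qed auto
      have "tensor_power K X 1 \<in> ?S" by blast
      then have "X \<in> ?S" by simp
      moreover have "X \<in> P"
        using X P by (auto simp: prime_radical_def primes_over_def Spc_def)
      ultimately show False using P by blast
    qed
  qed
qed

lemma tt_ideal_prime_radical: "tt_ideal K (prime_radical F)"
proof -
  \<comment> \<open>Inserting \<open>Ob K\<close> keeps the family nonempty even if no prime
    contains \<open>F\<close>.\<close>
  have "tt_ideal K (\<Inter>(insert (Ob K) (primes_over F)))"
    by (rule tt_ideal_Inter)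
      (use tt_ideal_Ob prime_ideal_tt_ideal in \<open>auto simp: primes_over_def Spc_def\<close>)
  also have "\<Inter>(insert (Ob K) (primes_over F)) = prime_radical F"
    unfolding prime_radical_def by blast
  finally show ?thesis .
qed

lemma subset_prime_radical: "F \<subseteq> Ob K \<Longrightarrow> F \<subseteq> prime_radical F"
  by (auto simp: prime_radical_def primes_over_def)

text \<open>\<open>primes_over\<close> and \<open>prime_radical\<close> behave like the two halves
  of an antitone Galois connection, so closing \<open>F\<close> does not change the primes over
  it.\<close>

lemma primes_over_prime_radical: "F \<subseteq> Ob K \<Longrightarrow> primes_over (prime_radical F) = primes_over F"
  by (auto simp: prime_radical_def primes_over_def)

lemma prime_radical_cong: "primes_over F = primes_over G \<Longrightarrow> prime_radical F = prime_radical G"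
  by (simp add: prime_radical_def)

lemma prime_radical_mono: "F \<subseteq> G \<Longrightarrow> prime_radical F \<subseteq> prime_radical G"
  by (auto simp: prime_radical_def primes_over_def)

lemma radical_ideal_iff: "radical_ideal K I \<longleftrightarrow> tt_ideal K I \<and> prime_radical I = I"
  unfolding radical_ideal_def using tt_radical_eq_prime_radical[of I] by metis

lemma radical_ideal_Ob_subset: "radical_ideal K I \<Longrightarrow> I \<subseteq> Ob K"
  by (rule tt_ideal_Ob_subset) (simp add: radical_ideal_def)

lemma radical_ideal_prime_radical: "F \<subseteq> Ob K \<Longrightarrow> radical_ideal K (prime_radical F)"
  by (simp add: radical_ideal_iff tt_ideal_prime_radical
      prime_radical_cong[OF primes_over_prime_radical])

text \<open>\<open>P\<close> is itself among the primes over \<open>P\<close>, so their intersection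
  cannot exceed it.\<close>

lemma prime_ideal_radical: "prime_ideal K P \<Longrightarrow> radical_ideal K P"
  using tt_ideal_Ob_subset[OF prime_ideal_tt_ideal] subset_prime_radical[of P]
  by (auto simp: radical_ideal_iff prime_ideal_tt_ideal prime_radical_def primes_over_def Spc_def)

text \<open>Membership in the radical is witnessed by a single power, so taking radicals commutes
  with unions.\<close>

lemma radical_ideal_Union_chain:
  assumes "\<I> \<noteq> {}" "\<And>I. I \<in> \<I> \<Longrightarrow> radical_ideal K I"
    and "\<And>I J. \<lbrakk>I \<in> \<I>; J \<in> \<I>\<rbrakk> \<Longrightarrow> I \<subseteq> J \<or> J \<subseteq> I"
  shows "radical_ideal K (\<Union>\<I>)"
proof -
  have "tt_ideal K (\<Union>\<I>)"
  proof (rule tt_ideal_Union_chain)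
    show "tt_ideal K I" if "I \<in> \<I>" for I
      using assms(2)[OF that] by (simp add: radical_ideal_def)
    show "I \<subseteq> J \<or> J \<subseteq> I" if "I \<in> \<I>" "J \<in> \<I>" for I J
      using that by (rule assms(3))
  qed (rule assms(1))
  moreover have "tt_radical K (\<Union>\<I>) = (\<Union>I\<in>\<I>. tt_radical K I)"
    by (auto simp: tt_radical_def)
  ultimately show ?thesis
    using assms(2) by (auto simp: radical_ideal_def)
qed

section \<open>Finite generation and the argument of Cohen's theorem\<close>

lemma fin_gen_radical_iff:
  "fin_gen_radical K I \<longleftrightarrow> (\<exists>F. finite F \<and> F \<subseteq> Ob K \<and> I = prime_radical F)"
proof -
  \<comment> \<open>A prime contains \<open>F\<close> exactly when it contains the ideal generated
    by \<open>F\<close>, so both sides are intersections of the same primes.\<close>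
  have "tt_radical K (ideal_generated K F) = prime_radical F" if F: "F \<subseteq> Ob K" for F
  proof -
    have "primes_over (ideal_generated K F) = primes_over F"
      using ideal_generated_subset_iff[OF prime_ideal_tt_ideal, of _ F]
      by (auto simp: primes_over_def Spc_def)
    then show ?thesis
      using tt_radical_eq_prime_radical[OF tt_ideal_ideal_generated[OF F]] prime_radical_cong
      by metis
  qed
  then show ?thesis
    unfolding fin_gen_radical_def by metis
qed

lemma fin_gen_radicalE:
  assumes "fin_gen_radical K I"
  obtains F where "finite F" "F \<subseteq> Ob K" "I = prime_radical F"
  using assms unfolding fin_gen_radical_iff by (elim exE conjE)

lemma fin_gen_radicalI:
  "\<lbrakk>finite F; F \<subseteq> Ob K; I = prime_radical F\<rbrakk> \<Longrightarrow> fin_gen_radical K I"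
  unfolding fin_gen_radical_iff by (intro exI conjI)

text \<open>If a prime misses some member of \<open>F\<close> and contains all products, then it
  contains every member of \<open>G\<close>. The pairwise products thus play the part of a product
  of ideals.\<close>

lemma primes_over_tensor:
  assumes "F \<subseteq> Ob K" "G \<subseteq> Ob K"
  shows "primes_over (case_prod (TenO K) ` (F \<times> G)) = primes_over F \<union> primes_over G"
proof -
  have "case_prod (TenO K) ` (F \<times> G) \<subseteq> P \<longleftrightarrow> F \<subseteq> P \<or> G \<subseteq> P" if "prime_ideal K P" for P
  proof -
    have "x \<odot> y \<in> P \<longleftrightarrow> x \<in> P \<or> y \<in> P" if "x \<in> F" "y \<in> G" for x y
      using \<open>prime_ideal K P\<close> that assms prime_ideal_tensor_iff by blast
    then show ?thesis by (auto simp: image_subset_iff subset_iff)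
  qed
  then show ?thesis
    by (auto simp: primes_over_def Spc_def)
qed

text \<open>Zorn's lemma gives a maximal radical ideal \<open>M\<close> that is not finitely
  generated, and \<open>M\<close> is shown to be prime. Were a product of \<open>X\<close> and
  \<open>Y\<close> in \<open>M\<close> but neither factor, then adjoining \<open>X\<close> or
  \<open>Y\<close> to \<open>M\<close> would give finitely generated radical ideals, and the
  products of their generators would generate \<open>M\<close>.\<close>

lemma radical_ideals_fin_gen:
  assumes prime: "\<And>P. prime_ideal K P \<Longrightarrow> fin_gen_radical K P" and "radical_ideal K I"
  shows "fin_gen_radical K I"
proof (rule ccontr)
  assume nfg: "\<not> fin_gen_radical K I"
  let ?A = "{J. radical_ideal K J \<and> \<not> fin_gen_radical K J}"
  \<comment> \<open>Finitely many generators of the union would lie in one member of the chain.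
    Being radical, that member would equal the union and be finitely generated.\<close>
  have "\<Union>C \<in> ?A" if "C \<noteq> {}" "subset.chain ?A C" for C
  proof -
    have C: "C \<subseteq> ?A" and chain: "\<And>I J. \<lbrakk>I \<in> C; J \<in> C\<rbrakk> \<Longrightarrow> I \<subseteq> J \<or> J \<subseteq> I"
      using that unfolding subset.chain_def by blast+
    have "radical_ideal K (\<Union>C)"
    proof (rule radical_ideal_Union_chain)
      show "I \<subseteq> J \<or> J \<subseteq> I" if "I \<in> C" "J \<in> C" for I J using that by (rule chain)
    qed (use C \<open>C \<noteq> {}\<close> in auto)
    moreover have "\<not> fin_gen_radical K (\<Union>C)"
    proof
      assume "fin_gen_radical K (\<Union>C)"
      then obtain F where F: "finite F" "F \<subseteq> Ob K" "\<Union>C = prime_radical F"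
        by (rule fin_gen_radicalE)
      then have "F \<subseteq> \<Union>C" using subset_prime_radical[of F] by simp
      then obtain J where J: "J \<in> C" "F \<subseteq> J"
        by (rule finite_subset_Union_chain[OF F(1) _ \<open>C \<noteq> {}\<close> \<open>subset.chain ?A C\<close>])
      have CA: "radical_ideal K J" "\<not> fin_gen_radical K J" using C J(1) by auto
      have "prime_radical J = J" using CA(1) unfolding radical_ideal_iff by (rule conjunct2)
      then have "prime_radical F \<subseteq> J" using prime_radical_mono[OF J(2)] by simp
      moreover have "J \<subseteq> prime_radical F" using J(1) unfolding F(3)[symmetric] by (rule Union_upper)
      ultimately have "J = prime_radical F" by (rule equalityI[rotated])
      with F(1,2) have "fin_gen_radical K J" by (rule fin_gen_radicalI)
      then show False using CA(2) by contradiction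
    qed
    ultimately show ?thesis by simp
  qed
  moreover have "?A \<noteq> {}" using assms(2) nfg by blast
  ultimately obtain M where M: "radical_ideal K M" "\<not> fin_gen_radical K M"
    and max: "\<And>J. J \<in> ?A \<Longrightarrow> M \<subseteq> J \<Longrightarrow> J = M"
    using subset_Zorn_nonempty[of ?A] by auto
  have MOb: "M \<subseteq> Ob K" using M(1) by (rule radical_ideal_Ob_subset)
  have bigger: "\<exists>F. finite F \<and> F \<subseteq> Ob K \<and> primes_over (insert X M) = primes_over F"
    if X: "X \<in> Ob K" "X \<notin> M" for X
  proof -
    have XM: "insert X M \<subseteq> Ob K" using X MOb by blast
    then have "fin_gen_radical K (prime_radical (insert X M))"
      using max[of "prime_radical (insert X M)"] radical_ideal_prime_radical[OF XM]
        subset_prime_radical[OF XM] X(2) by auto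
    then obtain F where F: "finite F" "F \<subseteq> Ob K" "prime_radical (insert X M) = prime_radical F"
      by (rule fin_gen_radicalE)
    then have "primes_over (insert X M) = primes_over F"
      using primes_over_prime_radical[OF XM] primes_over_prime_radical[OF F(2)] by simp
    with F(1,2) show ?thesis by blast
  qed
  have "X \<in> M \<or> Y \<in> M" if X: "X \<in> Ob K" and Y: "Y \<in> Ob K" and XY: "X \<odot> Y \<in> M" for X Y
  proof (rule ccontr)
    assume "\<not> (X \<in> M \<or> Y \<in> M)"
    then obtain F G where F: "finite F" "F \<subseteq> Ob K" "primes_over (insert X M) = primes_over F"
      and G: "finite G" "G \<subseteq> Ob K" "primes_over (insert Y M) = primes_over G"
      using bigger[OF X] bigger[OF Y] by blast
    let ?H = "case_prod (TenO K) ` (F \<times> G)"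
    \<comment> \<open>Every prime over \<open>M\<close> contains the product of \<open>X\<close> and
      \<open>Y\<close>, hence one of the factors.\<close>
    have "primes_over M = primes_over (insert X M) \<union> primes_over (insert Y M)"
      using prime_ideal_tensor_iff[OF _ X Y] XY by (auto simp: primes_over_def Spc_def)
    then have "primes_over M = primes_over ?H"
      using F(3) G(3) primes_over_tensor[OF F(2) G(2)] by simp
    then have "M = prime_radical ?H"
      using M(1) prime_radical_cong[of M ?H] radical_ideal_iff[of M] by simp
    moreover have "finite ?H" using F(1) G(1) by simp
    moreover have "?H \<subseteq> Ob K" using F(2) G(2) TenO_Ob by auto
    ultimately show False using M(2) fin_gen_radicalI[of ?H M] by simp
  qed
  \<comment> \<open>The whole category is generated by the unit object, which lies in no
    prime.\<close>
  moreover have "M \<noteq> Ob K"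
  proof
    assume "M = Ob K"
    then have "M = prime_radical {Unit K}"
      using Unit_notin_prime by (auto simp: prime_radical_def primes_over_def Spc_def)
    moreover have "{Unit K} \<subseteq> Ob K" using Unit_Ob by simp
    ultimately show False using M(2) fin_gen_radicalI[of "{Unit K}" M] by simp
  qed
  ultimately have "prime_ideal K M"
    using M(1) unfolding prime_ideal_def radical_ideal_def by blast
  then show False using prime M(2) by blast
qed

section \<open>The inverse topology\<close>

lemma complement_supp: "Spc K - supp K X = primes_over {X}"
  by (auto simp: supp_def primes_over_def)

lemma primes_over_subset_Spc: "primes_over F \<subseteq> Spc K"
  by (auto simp: primes_over_def)

lemma openin_Spc_iff:
  "openin (Spc_topology K) U \<longleftrightarrow>
     U \<subseteq> Spc K \<and> (\<forall>P\<in>U. \<exists>X\<in>Ob K. P \<in> primes_over {X} \<and> primes_over {X} \<subseteq> U)"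
proof -
  have "V \<subseteq> Spc K" if "\<exists>X\<in>Ob K. V = primes_over {X}" for V
    using that primes_over_subset_Spc by auto
  then show ?thesis
    unfolding openin_Spc_topology arbitrary_union_of_alt complement_supp by blast
qed

lemma openin_primes_over: "X \<in> Ob K \<Longrightarrow> openin (Spc_topology K) (primes_over {X})"
  unfolding openin_Spc_iff using primes_over_subset_Spc[of "{X}"] by blast

end

text \<open>The multiplicative set generated by \<open>A\<close>, with all bracketings and no
  identification up to isomorphism. The unit makes it nonempty even for empty
  \<open>A\<close>.\<close>

inductive_set tensor_closure :: "('o, 'm, 'z) tt_cat_scheme \<Rightarrow> 'o set \<Rightarrow> 'o set" for K A where
  unit: "Unit K \<in> tensor_closure K A"
| base: "X \<in> A \<Longrightarrow> X \<in> tensor_closure K A"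
| tensor: "\<lbrakk>X \<in> tensor_closure K A; Y \<in> tensor_closure K A\<rbrakk> \<Longrightarrow> X \<odot>\<^bsub>K\<^esub> Y \<in> tensor_closure K A"

context tt_category
begin

lemma tensor_closure_Ob:
  assumes "A \<subseteq> Ob K" "X \<in> tensor_closure K A"
  shows "X \<in> Ob K"
  using assms(2) by induction (use assms(1) Unit_Ob TenO_Ob in auto)

text \<open>\<open>B\<close> collects the members of \<open>A\<close> used as factors of
  \<open>w\<close>; a prime containing \<open>w\<close> contains one of them. For the unit,
  \<open>B\<close> is empty and the claim is vacuous.\<close>

lemma tensor_closure_finite_support:
  assumes A: "A \<subseteq> Ob K" and "w \<in> tensor_closure K A"
  shows "\<exists>B. finite B \<and> B \<subseteq> A \<and> (\<forall>P. prime_ideal K P \<longrightarrow> w \<in> P \<longrightarrow> B \<inter> P \<noteq> {})"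
  using assms(2)
proof induction
  case unit
  then show ?case using Unit_notin_prime by (intro exI[of _ "{}"]) auto
next
  case (base X)
  then show ?case by (intro exI[of _ "{X}"]) auto
next
  case (tensor X Y)
  then obtain B C where B: "finite B" "B \<subseteq> A" "finite C" "C \<subseteq> A"
    and meets: "\<And>P. prime_ideal K P \<Longrightarrow> X \<in> P \<Longrightarrow> B \<inter> P \<noteq> {}"
      "\<And>P. prime_ideal K P \<Longrightarrow> Y \<in> P \<Longrightarrow> C \<inter> P \<noteq> {}"
    by (elim exE conjE) metis
  have Ob: "X \<in> Ob K" "Y \<in> Ob K"
    using tensor.hyps tensor_closure_Ob[OF A] by simp_all
  have "(B \<union> C) \<inter> P \<noteq> {}" if P: "prime_ideal K P" "X \<odot> Y \<in> P" for P
    using prime_ideal_tensor_iff[OF P(1) Ob] P(2) meets[OF P(1)] by blast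
  with B show ?case by (intro exI[of _ "B \<union> C"]) simp
qed

text \<open>If the ideal generated by \<open>X\<close> were disjoint from the multiplicative set
  generated by \<open>A\<close>, some prime would contain \<open>X\<close> and no member of
  \<open>A\<close>, against the covering. So both share an object \<open>w\<close>. Every prime over
  \<open>X\<close> contains \<open>w\<close>, hence one of its finitely many factors from
  \<open>A\<close>.\<close>

lemma primes_over_finite_subcover:
  assumes X: "X \<in> Ob K" and A: "A \<subseteq> Ob K" and cover: "primes_over {X} \<subseteq> (\<Union>Y\<in>A. primes_over {Y})"
  obtains B where "finite B" "B \<subseteq> A" "primes_over {X} \<subseteq> (\<Union>Y\<in>B. primes_over {Y})"
proof -
  let ?I = "ideal_generated K {X}" and ?S = "tensor_closure K A"
  have I: "tt_ideal K ?I" using X by (simp add: tt_ideal_ideal_generated)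
  have "?I \<inter> ?S \<noteq> {}"
  proof
    assume disj: "?I \<inter> ?S = {}"
    obtain P where P: "prime_ideal K P" "?I \<subseteq> P" "P \<inter> ?S = {}"
    proof (rule prime_avoiding_multiplicative[OF I _ _ disj])
      show "?S \<subseteq> Ob K" using tensor_closure_Ob[OF A] by blast
      show "?S \<noteq> {}" using tensor_closure.unit[of K A] by blast
      show "\<exists>c\<in>?S. \<forall>J. tt_ideal K J \<longrightarrow> a \<odot> b \<in> J \<longrightarrow> c \<in> J" if "a \<in> ?S" "b \<in> ?S" for a b
        using tensor_closure.tensor[OF that] by blast
    qed
    have "X \<in> P" using P(2) ideal_generated_subset_iff[OF prime_ideal_tt_ideal[OF P(1)], of "{X}"] by simp
    then have "P \<in> primes_over {X}" using P(1) by (simp add: primes_over_def Spc_def)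
    then obtain Y where "Y \<in> A" "Y \<in> P" using cover by (auto simp: primes_over_def)
    then show False using P(3) tensor_closure.base[of Y A K] by blast
  qed
  then obtain w where w: "w \<in> ?I" "w \<in> ?S" by blast
  obtain B where B: "finite B" "B \<subseteq> A" "\<And>P. prime_ideal K P \<Longrightarrow> w \<in> P \<Longrightarrow> B \<inter> P \<noteq> {}"
    using tensor_closure_finite_support[OF A w(2)] by (elim exE conjE) metis
  have "primes_over {X} \<subseteq> (\<Union>Y\<in>B. primes_over {Y})"
  proof
    fix P assume "P \<in> primes_over {X}"
    then have P: "prime_ideal K P" "X \<in> P" by (auto simp: primes_over_def Spc_def)
    then have "w \<in> P"
      using w(1) ideal_generated_subset_iff[OF prime_ideal_tt_ideal[OF P(1)], of "{X}"] by auto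
    then show "P \<in> (\<Union>Y\<in>B. primes_over {Y})"
      using B(3)[OF P(1)] P(1) by (auto simp: primes_over_def Spc_def)
  qed
  with B(1,2) show thesis by (rule that)
qed

lemma compactin_primes_over:
  assumes X: "X \<in> Ob K"
  shows "compactin (Spc_topology K) (primes_over {X})"
  unfolding compactin_def topspace_Spc_topology
proof (intro conjI allI impI primes_over_subset_Spc)
  fix \<U>
  assume \<U>: "Ball \<U> (openin (Spc_topology K)) \<and> primes_over {X} \<subseteq> \<Union>\<U>"
  \<comment> \<open>The cover is refined to basic open sets, each lying in some member of the
    cover.\<close>
  define A where "A = {Y \<in> Ob K. \<exists>U\<in>\<U>. primes_over {Y} \<subseteq> U}"
  have "primes_over {X} \<subseteq> (\<Union>Y\<in>A. primes_over {Y})"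
  proof
    fix P assume "P \<in> primes_over {X}"
    then obtain U where U: "U \<in> \<U>" "P \<in> U" using \<U> by blast
    then have "openin (Spc_topology K) U" using \<U> by blast
    then obtain Y where "Y \<in> Ob K" "P \<in> primes_over {Y}" "primes_over {Y} \<subseteq> U"
      using U(2) unfolding openin_Spc_iff by blast
    then show "P \<in> (\<Union>Y\<in>A. primes_over {Y})" using U(1) unfolding A_def by blast
  qed
  then obtain B where B: "finite B" "B \<subseteq> A" "primes_over {X} \<subseteq> (\<Union>Y\<in>B. primes_over {Y})"
    by (rule primes_over_finite_subcover[OF X, rotated]) (auto simp: A_def)
  have "\<forall>Y\<in>B. \<exists>U\<in>\<U>. primes_over {Y} \<subseteq> U" using B(2) unfolding A_def by blast
  then obtain u where u: "\<And>Y. Y \<in> B \<Longrightarrow> u Y \<in> \<U> \<and> primes_over {Y} \<subseteq> u Y" by metis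
  then have "(\<Union>Y\<in>B. primes_over {Y}) \<subseteq> \<Union>(u ` B)" "u ` B \<subseteq> \<U>" by blast+
  with B(1,3) have "finite (u ` B) \<and> u ` B \<subseteq> \<U> \<and> primes_over {X} \<subseteq> \<Union>(u ` B)"
    by (meson finite_imageI order_trans)
  then show "\<exists>\<F>. finite \<F> \<and> \<F> \<subseteq> \<U> \<and> primes_over {X} \<subseteq> \<Union>\<F>" by blast
qed

lemma finite_union_primes_over:
  assumes "finite \<F>" "\<F> \<subseteq> (\<lambda>X. primes_over {X}) ` Ob K"
  shows "\<exists>W\<in>Ob K. \<Union>\<F> = primes_over {W}"
  using assms
proof (induction \<F>)
  case empty
  have "primes_over {Unit K} = {}"
    using Unit_notin_prime by (auto simp: primes_over_def Spc_def)
  then show ?case using Unit_Ob by auto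
next
  case (insert U \<F>)
  then obtain X W where "X \<in> Ob K" "U = primes_over {X}" "W \<in> Ob K" "\<Union>\<F> = primes_over {W}"
    by auto
  then have "\<Union>(insert U \<F>) = primes_over {X \<odot> W}"
    using primes_over_tensor[of "{X}" "{W}"] by simp
  then show ?case using TenO_Ob[OF \<open>X \<in> Ob K\<close> \<open>W \<in> Ob K\<close>] by blast
qed

text \<open>A quasi-compact open set is a finite union of basic open sets, and such a union is again
  basic: it belongs to the tensor product of the objects involved, or to the unit if it is
  empty.\<close>

lemma compact_open_Spc_iff:
  "openin (Spc_topology K) C \<and> compactin (Spc_topology K) C \<longleftrightarrow> (\<exists>X\<in>Ob K. C = primes_over {X})"
proof
  assume C: "openin (Spc_topology K) C \<and> compactin (Spc_topology K) C"
  let ?U = "{primes_over {X} | X. X \<in> Ob K \<and> primes_over {X} \<subseteq> C}"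
  have "C \<subseteq> \<Union>?U" using conjunct1[OF C] unfolding openin_Spc_iff by blast
  moreover have "Ball ?U (openin (Spc_topology K))" using openin_primes_over by auto
  ultimately obtain \<F> where F: "finite \<F>" "\<F> \<subseteq> ?U" "C \<subseteq> \<Union>\<F>"
    using C unfolding compactin_def by meson
  then have "C = \<Union>\<F>" by blast
  moreover have "\<F> \<subseteq> (\<lambda>X. primes_over {X}) ` Ob K" using F(2) by blast
  ultimately show "\<exists>X\<in>Ob K. C = primes_over {X}"
    using finite_union_primes_over[OF F(1)] by simp
qed (use openin_primes_over compactin_primes_over in auto)

section \<open>Closed sets and the chain condition in the inverse topology\<close>

lemma closedin_inverse_iff:
  "closedin (inverse_topology (Spc_topology K)) C \<longleftrightarrow> (\<exists>F\<subseteq>Ob K. C = primes_over F)"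
proof -
  let ?T = "inverse_topology (Spc_topology K)"
  \<comment> \<open>Complements of quasi-compact open sets are exactly the supports, so the open
    sets of the inverse topology are the unions of supports; taking complements gives the
    claim.\<close>
  have basic: "{V. \<exists>C. openin (Spc_topology K) C \<and> compactin (Spc_topology K) C \<and> V = Spc K - C}
      = supp K ` Ob K"
  proof -
    have "Spc K - primes_over {X} = supp K X" for X
      by (auto simp: primes_over_def supp_def)
    then have "supp K ` Ob K = {V. \<exists>C. (\<exists>X\<in>Ob K. C = primes_over {X}) \<and> V = Spc K - C}"
      by (auto simp: image_iff)
    then show ?thesis by (simp only: compact_open_Spc_iff[symmetric] conj_assoc)
  qed
  have open_iff: "openin ?T U \<longleftrightarrow> (\<exists>F\<subseteq>Ob K. \<Union>(supp K ` F) = U)" for U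
    unfolding openin_inverse_topology topspace_Spc_topology union_of_def arbitrary_def basic
    by (simp add: subset_image_iff) blast
  have supp_Union: "Spc K - \<Union>(supp K ` F) = primes_over F" for F
    by (auto simp: supp_def primes_over_def)
  show ?thesis
  proof
    assume "closedin ?T C"
    then have C: "C \<subseteq> Spc K" "openin ?T (Spc K - C)"
      by (auto simp: closedin_def topspace_inverse_topology topspace_Spc_topology)
    obtain F where F: "F \<subseteq> Ob K" "\<Union>(supp K ` F) = Spc K - C"
      using C(2) unfolding open_iff by (elim exE conjE)
    then have "C = primes_over F"
      using supp_Union[of F] C(1) by (simp add: double_diff)
    then show "\<exists>F\<subseteq>Ob K. C = primes_over F" using F(1) by blast
  next
    assume "\<exists>F\<subseteq>Ob K. C = primes_over F"
    then obtain F where F: "F \<subseteq> Ob K" "C = primes_over F" by blast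
    then have "Spc K - C = \<Union>(supp K ` F)"
      using supp_Union[of F] by (auto simp: supp_def)
    then have "openin ?T (Spc K - C)"
      unfolding open_iff using F(1) by (intro exI[of _ F]) simp
    then show "closedin ?T C"
      using F primes_over_subset_Spc
      by (simp add: closedin_def topspace_inverse_topology topspace_Spc_topology)
  qed
qed

text \<open>A descending chain of closed sets corresponds to an ascending chain of radical ideals.
  Its union is radical, and finitely many generators of it already lie in one term, where the chain
  becomes constant.\<close>

lemma inverse_noetherian_if_fin_gen:
  assumes fg: "\<And>I. radical_ideal K I \<Longrightarrow> fin_gen_radical K I"
  shows "inverse_noetherian (Spc_topology K)"
  unfolding inverse_noetherian_def noetherian_space_def
proof (intro allI impI)
  fix C :: "nat \<Rightarrow> 'o set set"
  assume "(\<forall>n. closedin (inverse_topology (Spc_topology K)) (C n)) \<and> decseq C"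
  then have "\<forall>n. \<exists>F\<subseteq>Ob K. C n = primes_over F" and dec: "decseq C"
    by (simp_all add: closedin_inverse_iff)
  then obtain F where F: "\<And>n. F n \<subseteq> Ob K" "\<And>n. C n = primes_over (F n)" by metis
  \<comment> \<open>The chosen families \<open>F n\<close> need not increase with \<open>n\<close>;
    their prime radicals do, and they determine the same closed sets.\<close>
  define R where "R n = prime_radical (F n)" for n
  have C_R: "C n = primes_over (R n)" for n
    using F primes_over_prime_radical R_def by simp
  have R_mono: "R m \<subseteq> R n" if "m \<le> n" for m n
    using decseqD[OF dec that] F(2) by (auto simp: R_def prime_radical_def)
  have R_radical: "radical_ideal K (R n)" for n
    using F radical_ideal_prime_radical R_def by simp
  have "radical_ideal K (\<Union>(range R))"
  proof (rule radical_ideal_Union_chain)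
    fix I J assume "I \<in> range R" "J \<in> range R"
    then obtain m n where "I = R m" "J = R n" by blast
    then show "I \<subseteq> J \<or> J \<subseteq> I" using R_mono nat_le_linear by metis
  qed (use R_radical in auto)
  then obtain G where G: "finite G" "G \<subseteq> Ob K" "\<Union>(range R) = prime_radical G"
    by (rule fin_gen_radicalE[OF fg])
  then have "G \<subseteq> (\<Union>n. R n)" using subset_prime_radical[of G] by simp
  with G(1) have "\<exists>N. G \<subseteq> R N"
  proof (induction G rule: finite_induct)
    case (insert x G)
    then obtain M N where "G \<subseteq> R M" "x \<in> R N" by auto
    then have "insert x G \<subseteq> R (max M N)"
      using R_mono[of M "max M N"] R_mono[of N "max M N"] by auto
    then show ?case by blast
  qed simp
  then obtain N where "G \<subseteq> R N" by blast
  then have "prime_radical G \<subseteq> R N"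
    using prime_radical_mono[of G "R N"] R_radical[of N] radical_ideal_iff[of "R N"] by simp
  then have "R n \<subseteq> R N" for n using G by blast
  then have "R n = R N" if "n \<ge> N" for n using R_mono[OF that] by blast
  then have "C n = C N" if "n \<ge> N" for n using that C_R by metis
  then show "\<exists>N. \<forall>n\<ge>N. C n = C N" by blast
qed

text \<open>If \<open>I\<close> is not finitely generated, a finite subset of \<open>I\<close> never
  has all of \<open>I\<close> as its radical. Adding one missing object at a time gives a descending
  chain of closed sets that never becomes constant.\<close>

lemma fin_gen_if_inverse_noetherian:
  assumes noeth: "inverse_noetherian (Spc_topology K)" and I: "radical_ideal K I"
  shows "fin_gen_radical K I"
proof (rule ccontr)
  assume nfg: "\<not> fin_gen_radical K I"
  have IOb: "I \<subseteq> Ob K" using I by (rule radical_ideal_Ob_subset)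
  have ex: "\<exists>x. x \<in> I - prime_radical F" if "finite F" "F \<subseteq> I" for F
  proof -
    have "prime_radical F \<subseteq> I"
      using prime_radical_mono[OF that(2)] I radical_ideal_iff[of I] by simp
    moreover have "prime_radical F \<noteq> I"
      using nfg that IOb fin_gen_radicalI[of F I] by auto
    ultimately show ?thesis by blast
  qed
  \<comment> \<open>The choice is meaningful as long as the set built so far is a finite subset of
    \<open>I\<close>, which is the invariant proved next.\<close>
  define F where "F = rec_nat {} (\<lambda>n F. insert (SOME x. x \<in> I - prime_radical F) F)"
  have F_Suc: "F (Suc n) = insert (SOME x. x \<in> I - prime_radical (F n)) (F n)" for n
    by (simp add: F_def)
  have F: "finite (F n) \<and> F n \<subseteq> I" for n
  proof (induction n)
    case 0
    then show ?case by (simp add: F_def)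
  next
    case (Suc n)
    then show ?case using someI_ex[OF ex[of "F n"]] F_Suc by simp
  qed
  have new: "\<not> F (Suc n) \<subseteq> prime_radical (F n)" for n
    using someI_ex[OF ex[of "F n"]] F[of n] F_Suc by simp
  have "closedin (inverse_topology (Spc_topology K)) (primes_over (F n))" for n
    unfolding closedin_inverse_iff using F[of n] IOb by blast
  moreover have "decseq (\<lambda>n. primes_over (F n))"
    using F_Suc by (intro decseq_SucI) (auto simp: primes_over_def)
  ultimately have "\<exists>N. \<forall>n\<ge>N. primes_over (F n) = primes_over (F N)"
    using noeth[unfolded inverse_noetherian_def noetherian_space_def, rule_format] by simp
  \<comment> \<open>Two consecutive equal terms suffice: the object added at step \<open>N\<close>
    would lie in the radical it was chosen to avoid.\<close>
  then obtain N where "primes_over (F (Suc N)) = primes_over (F N)"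
    using le_SucI[OF order_refl] by blast
  then have "prime_radical (F (Suc N)) = prime_radical (F N)"
    by (rule prime_radical_cong)
  moreover have "F (Suc N) \<subseteq> prime_radical (F (Suc N))"
    using F[of "Suc N"] IOb by (intro subset_prime_radical) blast
  ultimately show False using new[of N] by simp
qed

end

theorem theorem2:
  fixes K :: "('o, 'm) tt_cat"
  assumes "tt_category K"
  shows "((\<forall>I. radical_ideal K I \<longrightarrow> fin_gen_radical K I) \<longleftrightarrow>
          (\<forall>P. prime_ideal K P \<longrightarrow> fin_gen_radical K P)) \<and>
         ((\<forall>P. prime_ideal K P \<longrightarrow> fin_gen_radical K P) \<longleftrightarrow>
          inverse_noetherian (Spc_topology K))"
proof -
  interpret tt_category K by fact
  \<comment> \<open>All implications pass through (a), which is shown equivalent to (b) and to (c)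
    separately.\<close>
  have "\<forall>I. radical_ideal K I \<longrightarrow> fin_gen_radical K I"
    if "\<forall>P. prime_ideal K P \<longrightarrow> fin_gen_radical K P"
    using radical_ideals_fin_gen that by simp
  moreover have "\<forall>P. prime_ideal K P \<longrightarrow> fin_gen_radical K P"
    if "\<forall>I. radical_ideal K I \<longrightarrow> fin_gen_radical K I"
    using prime_ideal_radical that by simp
  moreover have "inverse_noetherian (Spc_topology K)"
    if "\<forall>I. radical_ideal K I \<longrightarrow> fin_gen_radical K I"
    using inverse_noetherian_if_fin_gen that by simp
  moreover have "\<forall>I. radical_ideal K I \<longrightarrow> fin_gen_radical K I"
    if "inverse_noetherian (Spc_topology K)"
    using fin_gen_if_inverse_noetherian[OF that] by simp
  ultimately show ?thesis by argo
qed

end
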